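(* Let $J\subsetneq I\subset S=K[x_1,\ldots,x_n]$ be monomial ideals, and let $g$ and the characteristic poset $P^g_{I/J}$ be as in the context. Then $\operatorname{fdepth}I/J$ is the maximum of the numbers $\operatorname{sdepth}\mathcal{D}(\mathcal{P})$, where the maximum is taken over all partitions $\mathcal{P}:\ P^g_{I/J}=\bigcup_{i=1}^r[c_i,d_i]$ of $P^g_{I/J}$ into intervals with the property that $\bigcup_{i=1}^j[c_i,d_i]$ is a poset ideal of $P^g_{I/J}$ for all $j$.
   Context: $K$ is a field and $S=K[x_1,\ldots,x_n]$ with its $\mathbb{Z}^n$-grading. For a finitely generated $\mathbb{Z}^n$-graded $S$-module $M$, a homogeneous $u\in M$ and $Z\subset\{x_1,\ldots,x_n\}$, $uK[Z]$ denotes the $K$-subspace of $M$ generated by all $uv$ with $v$ a monomial in $K[Z]$; it is a Stanley space of dimension $|Z|$ if it is a free $K[Z]$-module. A Stanley decomposition of $M$ is a presentation $\mathcal{D}: M=\bigoplus_{i=1}^m u_iK[Z_i]$ of $M$ as a finite direct sum of Stanley spaces, as $\mathbb{Z}^n$-graded $K$-vector spaces; $\operatorname{sdepth}\mathcal{D}=\min\{|Z_i|\}$. A prime filtration $\mathcal{F}$ of $M$ is a chain of $\mathbb{Z}^n$-graded submodules $0=M_0\subset M_1\subset\cdots\subset M_m=M$ with $M_i/M_{i-1}\cong(S/P_i)(-a_i)$, $a_i\in\mathbb{Z}^n$, $P_i$ a monomial prime ideal. Set $\operatorname{supp}\mathcal{F}=\{P_1,\ldots,P_m\}$, $\operatorname{fdepth}\mathcal{F}=\min\{\dim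 S/P: P\in\operatorname{supp}\mathcal{F}\}$, and let $\operatorname{fdepth}M$ be the maximum of $\operatorname{fdepth}\mathcal{F}$ over all prime filtrations $\mathcal{F}$ of $M$. For $a\in\mathbb{N}^n$ (with $0\in\mathbb{N}$), $x^a=x_1^{a(1)}\cdots x_n^{a(n)}$; $\mathbb{N}^n$ is partially ordered componentwise. Let $I$ be generated by monomials $x^{a_1},\ldots,x^{a_t}$ and $J$ by monomials $x^{b_1},\ldots,x^{b_s}$ (no $b_j$'s if $J=0$). Fix $g\in\mathbb{N}^n$ with $a_i\le g$ and $b_j\le g$ for all $i,j$. The characteristic poset of $I/J$ with respect to $g$ is $P^g_{I/J}=\{c\in\mathbb{N}^n: c\le g,\ a_i\le c \text{ for some } i,\ c\not\ge b_j\text{ for all } j\}$, a finite subposet of $\mathbb{N}^n$. For $a\le b$ in a poset $P$, $[a,b]=\{c\in P: a\le c\le b\}$ is an interval; a partition of a finite poset $P$ is a presentation $P=\bigcup_{i=1}^r[a_i,b_i]$ as a disjoint union of (nonempty) intervals. A poset ideal of $P$ here means an upward closed subset: $A\subset P$ such that $a\in A$, $e\in P$, $e\ge a$ imply $e\in A$. For $b\in P^g_{I/J}$ set $Z_b=\{x_j: b(j)=g(j)\}$. The module $I/J$ is identified with the $K$-span of the monomials in $I\setminus J$. A partition $\mathcal{P}: P^g_{I/J}=\bigcup_{i=1}^r[c_i,d_i]$ gives the Stanley decomposition $\mathcal{D}(\mathcal{P}): I/J=\bigoplus_{i=1}^r\big(\bigoplus_c x^cK[Z_{d_i}]\big)$,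 where the inner sum is over all $c\in[c_i,d_i]$ with $c(j)=c_i(j)$ for all $j$ with $x_j\in Z_{d_i}$. *)

theory Defs
  imports
    "HOL-Algebra.Algebra"
    "HOL-Algebra.Algebraic_Closure_Type"
    "HOL-Library.Poly_Mapping"
    "HOL-Library.Function_Algebras"
    "HOL-Library.Extended_Nat"
begin

subsection \<open>The polynomial ring and monomial ideals\<close>

text \<open>
  The finite type \<open>'n\<close> indexes the variables. Exponent vectors are plain functions
  \<open>'n \<Rightarrow> nat\<close>, so that \<open>\<le>\<close> on them is the componentwise order (unlike the
  order on \<open>'n \<Rightarrow>\<^sub>0 nat\<close>, which is lexicographic); their pointwise sum is the one of
  \<^theory>\<open>HOL-Library.Function_Algebras\<close>.
\<close>

type_synonym ('n, 'k) mpoly = "('n \<Rightarrow> nat) \<Rightarrow>\<^sub>0 'k"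

abbreviation mpoly_ring :: "('n::finite, 'k::field) mpoly ring"
  where "mpoly_ring \<equiv> ring_of_type_algebra"

definition xpow :: "('n::finite \<Rightarrow> nat) \<Rightarrow> ('n, 'k::field) mpoly"
  where "xpow a = Poly_Mapping.single a 1"

definition monomial_ideal :: "('n::finite \<Rightarrow> nat) set \<Rightarrow> ('n, 'k::field) mpoly set"
  where "monomial_ideal A = genideal mpoly_ring (xpow ` A)"

definition monomial_prime :: "('n::finite, 'k::field) mpoly set \<Rightarrow> bool"
  where "monomial_prime P \<longleftrightarrow> primeideal P mpoly_ring \<and> (\<exists>A. P = monomial_ideal A)"

text \<open>Krull dimension: the supremum of the lengths \<open>r\<close> of chains
  \<open>P\<^sub>0 \<subset> \<dots> \<subset> P\<^sub>r\<close> of prime ideals.\<close>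

definition krull_dim :: "('a, 'b) ring_scheme \<Rightarrow> enat"
  where "krull_dim R =
    Sup {enat (length ps - 1) |ps.
      ps \<noteq> [] \<and> (\<forall>P\<in>set ps. primeideal P R) \<and> sorted_wrt (\<subset>) ps}"


subsection \<open>\<open>\<int>\<^sup>n\<close>-graded modules\<close>

record ('r, 'm, 'n) gr_module = "('r, 'm) module" +
  hcomp :: "('n \<Rightarrow> int) \<Rightarrow> 'm set"

definition mpoly_module ::
    "(('n::finite, 'k::field) mpoly, ('n, 'k) mpoly, 'n) gr_module"
  where "mpoly_module =
    \<lparr>carrier = UNIV, monoid.mult = (*), one = 1, ring.zero = 0, ring.add = (+), module.smult = (*),
     hcomp = (\<lambda>d. {f. \<forall>a\<in>Poly_Mapping.keys f. \<forall>j. int (a j) = d j})\<rparr>"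

definition gr_submodule ::
    "'m set \<Rightarrow> (('n::finite, 'k::field) mpoly, 'm, 'n) gr_module \<Rightarrow> bool"
  where "gr_submodule N M \<longleftrightarrow>
    submodule N mpoly_ring M \<and>
    (\<forall>u\<in>N. \<exists>D v. finite D \<and> (\<forall>d\<in>D. v d \<in> N \<inter> hcomp M d) \<and> u = finsum M v D)"

text \<open>
  The subquotient \<open>L / N\<close> of \<open>M\<close>, with cosets of \<open>N\<close> as elements and the induced grading.
  The ring fields \<^const>\<open>monoid.mult\<close> and \<^const>\<open>one\<close>, which every module record inherits, have no
  meaning for a module.
\<close>

definition gr_quot ::
    "('r, 'm, 'n) gr_module \<Rightarrow> 'm set \<Rightarrow> 'm set \<Rightarrow> ('r, 'm set, 'n) gr_module"
  where "gr_quot M L N =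
    \<lparr>carrier = (\<lambda>u. N +>\<^bsub>M\<^esub> u) ` L,
     monoid.mult = undefined, one = undefined,
     ring.zero = N,
     ring.add = set_add M,
     module.smult = (\<lambda>s C. {(s \<odot>\<^bsub>M\<^esub> u) \<oplus>\<^bsub>M\<^esub> v |u v. u \<in> C \<and> v \<in> N}),
     hcomp = (\<lambda>d. (\<lambda>u. N +>\<^bsub>M\<^esub> u) ` (L \<inter> hcomp M d))\<rparr>"

text \<open>The shift \<open>M(a)\<close>, with \<open>M(a)\<^sub>d = M\<^bsub>a + d\<^esub>\<close>.\<close>

definition gr_shift ::
    "('r, 'm, 'n) gr_module \<Rightarrow> ('n \<Rightarrow> int) \<Rightarrow> ('r, 'm, 'n) gr_module"
  where "gr_shift M a = M\<lparr>hcomp := (\<lambda>d. hcomp M (a + d))\<rparr>"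

definition gr_iso ::
    "(('n::finite, 'k::field) mpoly, 'm, 'n) gr_module \<Rightarrow>
     (('n, 'k) mpoly, 'l, 'n) gr_module \<Rightarrow> bool"
  where "gr_iso M N \<longleftrightarrow>
    (\<exists>\<phi>. bij_betw \<phi> (carrier M) (carrier N) \<and>
      (\<forall>u\<in>carrier M. \<forall>v\<in>carrier M. \<phi> (u \<oplus>\<^bsub>M\<^esub> v) = \<phi> u \<oplus>\<^bsub>N\<^esub> \<phi> v) \<and>
      (\<forall>s. \<forall>u\<in>carrier M. \<phi> (s \<odot>\<^bsub>M\<^esub> u) = s \<odot>\<^bsub>N\<^esub> \<phi> u) \<and>
      (\<forall>d. \<phi> ` hcomp M d = hcomp N d))"


subsection \<open>Prime filtrations\<close>

text \<open>\<open>Ms\<close> lists \<open>M\<^sub>0, \<dots>, M\<^sub>m\<close> and \<open>Ps\<close> lists \<open>P\<^sub>1, \<dots>, P\<^sub>m\<close>, so that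
  \<open>P\<^sub>i\<close> is \<open>Ps ! (i - 1)\<close>.\<close>

definition prime_filtration ::
    "(('n::finite, 'k::field) mpoly, 'm, 'n) gr_module \<Rightarrow>
     'm set list \<Rightarrow> ('n, 'k) mpoly set list \<Rightarrow> bool"
  where "prime_filtration M Ms Ps \<longleftrightarrow>
    length Ms = length Ps + 1 \<and>
    (\<forall>N\<in>set Ms. gr_submodule N M) \<and>
    Ms ! 0 = {\<zero>\<^bsub>M\<^esub>} \<and> Ms ! length Ps = carrier M \<and>
    (\<forall>i<length Ps.
      Ms ! i \<subset> Ms ! (i + 1) \<and>
      monomial_prime (Ps ! i) \<and>
      (\<exists>a. gr_iso (gr_quot M (Ms ! (i + 1)) (Ms ! i))
                  (gr_shift (gr_quot mpoly_module UNIV (Ps ! i)) (- a))))"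

text \<open>Minimum and maximum are taken in the complete lattice \<^typ>\<open>enat\<close>. They are attained for
  nonzero finitely generated \<open>M\<close>; for \<open>M = 0\<close> the value is \<open>\<infinity>\<close>.\<close>

definition fdepth_filtration :: "('n::finite, 'k::field) mpoly set list \<Rightarrow> enat"
  where "fdepth_filtration Ps = (INF P\<in>set Ps. krull_dim (mpoly_ring Quot P))"

definition fdepth :: "(('n::finite, 'k::field) mpoly, 'm, 'n) gr_module \<Rightarrow> enat"
  where "fdepth M = Sup {fdepth_filtration Ps |Ms Ps. prime_filtration M Ms Ps}"


subsection \<open>The characteristic poset, its partitions, and Stanley decompositions\<close>

definition char_poset ::
    "('n::finite \<Rightarrow> nat) set \<Rightarrow> ('n \<Rightarrow> nat) set \<Rightarrow> ('n \<Rightarrow> nat) \<Rightarrow> ('n \<Rightarrow> nat) set"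
  where "char_poset A B g = {c. c \<le> g \<and> (\<exists>a\<in>A. a \<le> c) \<and> (\<forall>b\<in>B. \<not> b \<le> c)}"

definition poset_interval :: "'p::order set \<Rightarrow> 'p \<Rightarrow> 'p \<Rightarrow> 'p set"
  where "poset_interval P a b = {c\<in>P. a \<le> c \<and> c \<le> b}"

definition interval_partition :: "'p::order set \<Rightarrow> ('p \<times> 'p) list \<Rightarrow> bool"
  where "interval_partition P cds \<longleftrightarrow>
    (\<forall>(c, d)\<in>set cds. c \<in> P \<and> d \<in> P \<and> c \<le> d) \<and>
    (\<forall>i<length cds. \<forall>j<length cds. i \<noteq> j \<longrightarrow>
      poset_interval P (fst (cds ! i)) (snd (cds ! i)) \<inter>
      poset_interval P (fst (cds ! j)) (snd (cds ! j)) = {}) \<and>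
    (\<Union>(c, d)\<in>set cds. poset_interval P c d) = P"

text \<open>Poset ideals are upward closed here.\<close>

definition poset_ideal :: "'p::order set \<Rightarrow> 'p set \<Rightarrow> bool"
  where "poset_ideal P A \<longleftrightarrow> A \<subseteq> P \<and> (\<forall>a\<in>A. \<forall>e\<in>P. a \<le> e \<longrightarrow> e \<in> A)"

definition Zvars :: "('n::finite \<Rightarrow> nat) \<Rightarrow> ('n \<Rightarrow> nat) \<Rightarrow> 'n set"
  where "Zvars g b = {j. b j = g j}"

text \<open>
  A Stanley decomposition \<open>M = \<Oplus> u\<^sub>i K[Z\<^sub>i]\<close> is given by the set of its pairs
  \<open>(u\<^sub>i, Z\<^sub>i)\<close>; no pair can occur twice, the sum being direct and the summands nonzero.
  In \<open>stanley_decomp\<close> the \<open>u\<^sub>i\<close> are the residue classes modulo \<open>J\<close> of the monomials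
  \<open>x\<^sup>c\<close>, as elements of \<open>I/J\<close>.
\<close>

definition sdepth_decomp :: "('m \<times> 'n::finite set) set \<Rightarrow> nat"
  where "sdepth_decomp \<D> = Min ((\<lambda>(u, Z). card Z) ` \<D>)"

definition stanley_decomp ::
    "('n::finite \<Rightarrow> nat) set \<Rightarrow> ('n, 'k::field) mpoly set \<Rightarrow> ('n \<Rightarrow> nat) \<Rightarrow>
     (('n \<Rightarrow> nat) \<times> ('n \<Rightarrow> nat)) list \<Rightarrow> (('n, 'k) mpoly set \<times> 'n set) set"
  where "stanley_decomp P J g cds =
    {(J +>\<^bsub>mpoly_module\<^esub> xpow c, Zvars g di) |ci di c.
      (ci, di) \<in> set cds \<and> c \<in> poset_interval P ci di \<and> (\<forall>j\<in>Zvars g di. c j = ci j)}"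

end

theory Submission
  imports Defs
begin

text \<open>
  The \<open>\<int>\<^sup>n\<close>-graded components of \<open>I/J\<close> have dimension at most one, so its graded submodules are
  spanned by monomials and correspond to upward closed sets of exponents between those of \<open>J\<close>
  and those of \<open>I\<close>. Such a subquotient is a shifted \<open>S/P\<^sub>Z\<close>, where \<open>P\<^sub>Z\<close> is generated by the variables
  outside \<open>Z\<close>, exactly when the difference of the two exponent sets is a cone
  \<open>c + \<nat>\<^sup>Z\<close>. A prime filtration is therefore a way to build the exponents of \<open>I\<close> from those of
  \<open>J\<close> by adding disjoint cones, upward closed at every stage. Intersecting the cones with
  \<open>{c. c \<le> g}\<close> gives the nonempty intervals of an ordered partition of the characteristic poset,
  with \<open>Z \<subseteq> Z\<^sub>d\<close> for the upper end \<open>d\<close>. Conversely, the exponents \<open>e\<close> with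
  \<open>min e g \<in> [c, d]\<close> are a disjoint union of cones in the directions \<open>Z\<^sub>d\<close>, which can be added one at
  a time, larger apexes first. The depths agree because \<open>dim S/P\<^sub>Z = |Z|\<close>.
\<close>

subsection \<open>Ideals of a commutative ring type\<close>

text \<open>The upper bound dim S/P_Z <= |Z| is reached by counting: the witnesses of strictness in
  a chain of r + 1 primes above P_Z can be taken in K[Z], their power products are linearly
  independent over K, and too many of them would fit into a box of monomials unless r <= |Z|. On the
  combinatorial side everything rests on the truncation e |-> min e g: since all generators lie
  below g, an exponent belongs to I or to J exactly when its truncation does, so the finite poset
  decides about all exponents. The two passages between cones and intervals are not inverse to each
  other. A cone whose apex is not below g misses the poset and is dropped, and the upper end of an
  interval may touch g in more directions than the cone has; both changes can only increase the
  minimum of the dimensions. In the other direction one interval splits in general into several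
  cones of the same dimension, namely the summands that it contributes to the Stanley decomposition
  of the partition.\<close>

definition is_ideal :: "'a::comm_ring_1 set \<Rightarrow> bool"
  where "is_ideal I \<longleftrightarrow> 0 \<in> I \<and> (\<forall>u\<in>I. \<forall>v\<in>I. u + v \<in> I) \<and> (\<forall>s. \<forall>u\<in>I. s * u \<in> I)"

definition is_prime :: "'a::comm_ring_1 set \<Rightarrow> bool"
  where "is_prime P \<longleftrightarrow> is_ideal P \<and> 1 \<notin> P \<and> (\<forall>u v. u * v \<in> P \<longrightarrow> u \<in> P \<or> v \<in> P)"

lemma is_idealD:
  assumes "is_ideal I"
  shows "0 \<in> I" and "u \<in> I \<Longrightarrow> v \<in> I \<Longrightarrow> u + v \<in> I" and "u \<in> I \<Longrightarrow> s * u \<in> I"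
    and "u \<in> I \<Longrightarrow> u * s \<in> I" and "u \<in> I \<Longrightarrow> - u \<in> I" and "u \<in> I \<Longrightarrow> v \<in> I \<Longrightarrow> u - v \<in> I"
proof -
  show 0: "0 \<in> I" and add: "\<And>u v. u \<in> I \<Longrightarrow> v \<in> I \<Longrightarrow> u + v \<in> I"
    and mult: "\<And>s u. u \<in> I \<Longrightarrow> s * u \<in> I"
    using assms by (auto simp: is_ideal_def)
  show "u \<in> I \<Longrightarrow> u * s \<in> I" using mult[of u s] by (simp add: mult.commute)
  show uminus: "u \<in> I \<Longrightarrow> - u \<in> I" for u using mult[of u "-1"] by simp
  show "u \<in> I \<Longrightarrow> v \<in> I \<Longrightarrow> u - v \<in> I" using add[OF _ uminus] by simp
qed

lemma is_ideal_sum: "is_ideal I \<Longrightarrow> (\<And>x. x \<in> D \<Longrightarrow> f x \<in> I) \<Longrightarrow> sum f D \<in> I"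
  by (induction D rule: infinite_finite_induct) (auto simp: is_idealD)

lemma is_ideal_diff_left_iff: "is_ideal I \<Longrightarrow> u - v \<in> I \<Longrightarrow> u \<in> I \<longleftrightarrow> v \<in> I"
  using is_idealD(2)[of I "u - v" v] is_idealD(6)[of I u "u - v"] by auto

lemma type_ring_simps [simp]:
  "carrier ring_of_type_algebra = UNIV" "\<one>\<^bsub>ring_of_type_algebra\<^esub> = 1"
  "\<zero>\<^bsub>ring_of_type_algebra\<^esub> = 0" "x \<oplus>\<^bsub>ring_of_type_algebra\<^esub> y = x + y"
  "x \<otimes>\<^bsub>ring_of_type_algebra\<^esub> y = x * y"
  by (simp_all add: ring_of_type_algebra_def)

lemma type_ring_a_inv: "\<ominus>\<^bsub>ring_of_type_algebra\<^esub> (x :: 'a::comm_ring_1) = - x"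
proof -
  interpret cring "ring_of_type_algebra :: 'a ring" by (rule cring_from_type_algebra)
  show ?thesis using minus_equality[of "-x" x] by simp
qed

text \<open>With carrier \<open>UNIV\<close> all carrier conditions disappear, so ideals can be
  handled as plain sets closed under the class operations. This and
  \<open>primeideal_type_ring_iff\<close> are the bridge to the locale predicates in which the
  theorem is phrased.\<close>

lemma ideal_type_ring_iff: "ideal I (ring_of_type_algebra :: 'a::comm_ring_1 ring) \<longleftrightarrow> is_ideal I"
proof
  assume "ideal I (ring_of_type_algebra :: 'a ring)"
  then interpret ideal I "ring_of_type_algebra :: 'a ring" .
  show "is_ideal I"
    unfolding is_ideal_def
    using additive_subgroup.zero_closed[OF is_additive_subgroup]
      additive_subgroup.a_closed[OF is_additive_subgroup] I_l_closed by auto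
next
  assume I: "is_ideal I"
  interpret cring "ring_of_type_algebra :: 'a ring" by (rule cring_from_type_algebra)
  show "ideal I (ring_of_type_algebra :: 'a ring)"
  proof (rule idealI)
    show "subgroup I (add_monoid (ring_of_type_algebra :: 'a ring))"
      using is_idealD[OF I]
      by (intro add.subgroupI) (auto simp: type_ring_a_inv simp flip: a_inv_def)
  qed (use is_idealD[OF I] in \<open>auto intro: ring_axioms\<close>)
qed

lemma primeideal_type_ring_iff:
  "primeideal P (ring_of_type_algebra :: 'a::comm_ring_1 ring) \<longleftrightarrow> is_prime P"
proof
  assume "primeideal P (ring_of_type_algebra :: 'a ring)"
  then interpret primeideal P "ring_of_type_algebra :: 'a ring" .
  have "is_ideal P" using ideal_type_ring_iff is_ideal by blast
  moreover have "1 \<notin> P" using I_notcarr one_imp_carrier by auto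
  ultimately show "is_prime P" using I_prime by (auto simp: is_prime_def)
next
  assume P: "is_prime P"
  interpret cring "ring_of_type_algebra :: 'a ring" by (rule cring_from_type_algebra)
  show "primeideal P (ring_of_type_algebra :: 'a ring)"
    using P ideal_type_ring_iff by (intro primeidealI is_cring) (auto simp: is_prime_def)
qed

subsection \<open>Monomial ideals and monomial primes\<close>

definition up_closed :: "'a::order set \<Rightarrow> bool"
  where "up_closed E \<longleftrightarrow> (\<forall>a\<in>E. \<forall>b\<ge>a. b \<in> E)"

definition upset :: "'a::order set \<Rightarrow> 'a set"
  where "upset A = {e. \<exists>a\<in>A. a \<le> e}"

lemma up_closed_upset: "up_closed (upset A)"
  by (auto simp: up_closed_def upset_def intro: order_trans)

text \<open>Only the support of a polynomial is tested. For upward closed \<open>E\<close> this is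
  the monomial ideal with exponent set \<open>E\<close>; for \<open>Z_exponents Z\<close> it is the
  subring K[Z], and for an exponent box a finite-dimensional subspace.\<close>

definition monomial_span :: "('n \<Rightarrow> nat) set \<Rightarrow> ('n::finite, 'k::field) mpoly set"
  where "monomial_span E = {f. Poly_Mapping.keys f \<subseteq> E}"

lemma monomial_span_mono: "E \<subseteq> F \<Longrightarrow> monomial_span E \<subseteq> monomial_span F"
  by (auto simp: monomial_span_def)

lemma xpow_in_monomial_span [simp]: "xpow e \<in> monomial_span E \<longleftrightarrow> e \<in> E"
  by (simp add: monomial_span_def xpow_def)

lemma xpow_0: "xpow 0 = 1"
  by (simp add: xpow_def)

lemma exponent_le_iff_add: "(a :: 'n \<Rightarrow> nat) \<le> b \<longleftrightarrow> (\<exists>c. b = a + c)"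
proof
  assume "a \<le> b"
  then have "b = a + (\<lambda>j. b j - a j)" by (auto simp: le_fun_def fun_eq_iff)
  then show "\<exists>c. b = a + c" by blast
qed (auto simp: le_fun_def)

lemma poly_mapping_sum_single: "f = (\<Sum>e\<in>Poly_Mapping.keys f. Poly_Mapping.single e (Poly_Mapping.lookup f e))"
proof (rule poly_mapping_eqI)
  fix e
  have "Poly_Mapping.lookup (\<Sum>e\<in>Poly_Mapping.keys f. Poly_Mapping.single e (Poly_Mapping.lookup f e)) e =
      (\<Sum>a\<in>Poly_Mapping.keys f. if a = e then Poly_Mapping.lookup f a else 0)"
    by (simp add: lookup_sum lookup_single when_def)
  also have "\<dots> = Poly_Mapping.lookup f e" by (simp add: in_keys_iff)
  finally show "Poly_Mapping.lookup f e = Poly_Mapping.lookup (\<Sum>e\<in>Poly_Mapping.keys f. Poly_Mapping.single e (Poly_Mapping.lookup f e)) e" ..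
qed

text \<open>Turns a coefficient into multiplication by a ring element, so that closure properties of
  ideals apply to single terms.\<close>

lemma single_eq_const_mult_xpow:
  "Poly_Mapping.single e c = Poly_Mapping.single 0 c * xpow e"
  by (simp add: xpow_def mult_single)

lemma is_ideal_monomial_span:
  assumes "up_closed E"
  shows "is_ideal (monomial_span E :: ('n::finite, 'k::field) mpoly set)"
  unfolding is_ideal_def
proof (intro conjI ballI allI)
  fix u v s :: "('n, 'k) mpoly" assume u: "u \<in> monomial_span E"
  show "u + v \<in> monomial_span E" if "v \<in> monomial_span E"
    using u that Poly_Mapping.keys_add[of u v] by (auto simp: monomial_span_def)
  have "a + b \<in> E" if "b \<in> E" for a b :: "'n \<Rightarrow> nat"
    using assms that exponent_le_iff_add[of b "a + b"] by (auto simp: up_closed_def add.commute)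
  then show "s * u \<in> monomial_span E"
    using u keys_mult[of s u] by (fastforce simp: monomial_span_def)
qed (simp add: monomial_span_def)

lemma monomial_span_subset_ideal:
  fixes I :: "('n::finite, 'k::field) mpoly set"
  assumes "is_ideal I" and "\<And>e. e \<in> E \<Longrightarrow> xpow e \<in> I"
  shows "monomial_span E \<subseteq> I"
proof
  fix f :: "('n, 'k) mpoly" assume "f \<in> monomial_span E"
  then have "Poly_Mapping.single e (Poly_Mapping.lookup f e) \<in> I" if "e \<in> Poly_Mapping.keys f" for e
    using assms that is_idealD(3)[OF assms(1)]
    by (subst single_eq_const_mult_xpow) (auto simp: monomial_span_def)
  then show "f \<in> I"
    by (subst poly_mapping_sum_single) (rule is_ideal_sum[OF assms(1)])
qed

text \<open>The span of an upward closed set is an ideal, which gives one inclusion; each monomial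
  above a generator is a multiple of it, which gives the other. Ideal membership thereby becomes a
  condition on supports.\<close>

lemma monomial_ideal_eq:
  "monomial_ideal A = (monomial_span (upset A) :: ('n::finite, 'k::field) mpoly set)"
proof
  have "is_ideal (monomial_span (upset A) :: ('n, 'k) mpoly set)"
    by (rule is_ideal_monomial_span[OF up_closed_upset])
  moreover have "xpow ` A \<subseteq> (monomial_span (upset A) :: ('n, 'k) mpoly set)"
    by (auto simp: upset_def)
  ultimately show "monomial_ideal A \<subseteq> (monomial_span (upset A) :: ('n, 'k) mpoly set)"
    unfolding monomial_ideal_def genideal_def ideal_type_ring_iff by blast
next
  show "(monomial_span (upset A) :: ('n, 'k) mpoly set) \<subseteq> monomial_ideal A"
    unfolding monomial_ideal_def genideal_def ideal_type_ring_iff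
  proof (intro Inter_greatest)
    fix I :: "('n, 'k) mpoly set" assume "I \<in> {I. is_ideal I \<and> xpow ` A \<subseteq> I}"
    then have I: "is_ideal I" and A: "xpow ` A \<subseteq> I" by auto
    show "monomial_span (upset A) \<subseteq> I"
    proof (rule monomial_span_subset_ideal[OF I])
      fix e assume "e \<in> upset A"
      then obtain a c where "a \<in> A" "e = a + c"
        by (auto simp: upset_def exponent_le_iff_add)
      then have "xpow e = xpow c * (xpow a :: ('n, 'k) mpoly)" "xpow a \<in> I"
        using A by (auto simp: xpow_def mult_single add.commute)
      then show "xpow e \<in> I" using is_idealD(3)[OF I] by metis
    qed
  qed
qed

section \<open>Primes generated by variables\<close>

definition Z_exponents :: "'n set \<Rightarrow> ('n \<Rightarrow> nat) set"
  where "Z_exponents Z = {e. \<forall>j. j \<notin> Z \<longrightarrow> e j = 0}"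

text \<open>The ideal generated by the variables outside \<open>Z\<close>, described through its
  monomials. K[Z] is a vector space complement, and \<open>Z = UNIV\<close> gives the zero
  ideal.\<close>

definition Z_prime :: "'n set \<Rightarrow> ('n::finite, 'k::field) mpoly set"
  where "Z_prime Z = monomial_span (- Z_exponents Z)"

lemma Z_prime_alt: "Z_prime Z = {f. Poly_Mapping.keys f \<inter> Z_exponents Z = {}}"
  by (auto simp: Z_prime_def monomial_span_def)

lemma up_closed_compl_Z_exponents: "up_closed (- Z_exponents Z)"
  by (auto simp: up_closed_def Z_exponents_def le_fun_def) (metis le_0_eq)

lemma is_ideal_Z_prime: "is_ideal (Z_prime Z)"
  unfolding Z_prime_def by (rule is_ideal_monomial_span[OF up_closed_compl_Z_exponents])

text \<open>
  The componentwise order on exponents is not linear, so minimal exponents of two factors are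
  chosen after an additive embedding into the linearly ordered \<open>nat \<Rightarrow>\<^sub>0 nat\<close>.
\<close>

definition exponent_key :: "('n::finite \<Rightarrow> nat) \<Rightarrow> (nat \<Rightarrow>\<^sub>0 nat)"
  where "exponent_key e = (\<Sum>j\<in>UNIV. Poly_Mapping.single (to_nat_on UNIV j) (e j))"

lemma exponent_key_add: "exponent_key (a + b) = exponent_key a + exponent_key b"
  by (simp add: exponent_key_def single_add sum.distrib)

lemma lookup_exponent_key: "Poly_Mapping.lookup (exponent_key e) (to_nat_on UNIV j) = e j"
proof -
  have "inj (to_nat_on (UNIV :: 'a set))" by (rule inj_on_to_nat_on) (simp add: countable_finite)
  then have "Poly_Mapping.lookup (exponent_key e) (to_nat_on UNIV j) = (\<Sum>i\<in>UNIV. if i = j then e i else 0)"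
    unfolding exponent_key_def lookup_sum
    by (intro sum.cong) (auto simp: lookup_single when_def inj_def)
  then show ?thesis by simp
qed

lemma inj_exponent_key: "inj exponent_key"
  by (rule injI) (metis lookup_exponent_key ext)

text \<open>Uniqueness is demanded only within the supports, and neither \<open>a\<close> nor
  \<open>b\<close> has to lie there: if one is missing, both sides vanish. This serves for the least
  exponents of two factors as well as for multiplication by \<open>xpow c\<close>.\<close>

lemma coeff_mult_unique:
  fixes f h :: "('n::finite, 'k::field) mpoly"
  assumes "\<And>a' b'. a' \<in> Poly_Mapping.keys f \<Longrightarrow> b' \<in> Poly_Mapping.keys h \<Longrightarrow> a' + b' = a + b \<Longrightarrow> a' = a \<and> b' = b"
  shows "Poly_Mapping.lookup (f * h) (a + b) = Poly_Mapping.lookup f a * Poly_Mapping.lookup h b"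
proof -
  have "f * h = (\<Sum>a'\<in>Poly_Mapping.keys f. \<Sum>b'\<in>Poly_Mapping.keys h.
      Poly_Mapping.single (a' + b') (Poly_Mapping.lookup f a' * Poly_Mapping.lookup h b'))"
    by (subst (1) poly_mapping_sum_single[of f], subst (1) poly_mapping_sum_single[of h])
      (simp add: sum_product mult_single)
  then have "Poly_Mapping.lookup (f * h) (a + b) = (\<Sum>a'\<in>Poly_Mapping.keys f. \<Sum>b'\<in>Poly_Mapping.keys h.
      if a' + b' = a + b then Poly_Mapping.lookup f a' * Poly_Mapping.lookup h b' else 0)"
    by (simp add: lookup_sum lookup_single when_def)
  also have "\<dots> = (\<Sum>a'\<in>Poly_Mapping.keys f. \<Sum>b'\<in>Poly_Mapping.keys h.
      if a' = a \<and> b' = b then Poly_Mapping.lookup f a' * Poly_Mapping.lookup h b' else 0)"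
    using assms by (intro sum.cong refl) auto
  also have "\<dots> = (\<Sum>a'\<in>Poly_Mapping.keys f. if a' = a then 
      (\<Sum>b'\<in>Poly_Mapping.keys h. if b' = b then Poly_Mapping.lookup f a' * Poly_Mapping.lookup h b' else 0) else 0)"
    by (intro sum.cong refl) auto
  also have "\<dots> = Poly_Mapping.lookup f a * Poly_Mapping.lookup h b"
    by (simp add: in_keys_iff)
  finally show ?thesis .
qed

text \<open>A lowest-term argument inside K[Z]: among the exponents of \<open>f\<close> and of
  \<open>h\<close> in \<open>Z_exponents Z\<close>, the least ones \<open>a\<close> and
  \<open>b\<close> in the linear order give a term of \<open>f * h\<close> that cannot
  cancel.\<close>

lemma is_prime_Z_prime: "is_prime (Z_prime Z :: ('n::finite, 'k::field) mpoly set)"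
  unfolding is_prime_def
proof (intro conjI allI impI)
  show "is_ideal (Z_prime Z :: ('n, 'k) mpoly set)" by (rule is_ideal_Z_prime)
  show "1 \<notin> (Z_prime Z :: ('n, 'k) mpoly set)"
    by (simp add: Z_prime_def Z_exponents_def flip: xpow_0)
next
  fix f h :: "('n, 'k) mpoly" assume fh: "f * h \<in> Z_prime Z"
  show "f \<in> Z_prime Z \<or> h \<in> Z_prime Z"
  proof (rule ccontr)
    assume fh': "\<not> ?thesis"
    define F where "F = Poly_Mapping.keys f \<inter> Z_exponents Z"
    define H where "H = Poly_Mapping.keys h \<inter> Z_exponents Z"
    have FH: "F \<noteq> {}" "H \<noteq> {}" "finite F" "finite H"
      using fh' by (auto simp: Z_prime_alt F_def H_def)
    obtain a where a: "a \<in> F" "\<And>a'. a' \<in> F \<Longrightarrow> exponent_key a \<le> exponent_key a'"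
      using FH by (metis arg_min_if_finite(1) arg_min_least)
    obtain b where b: "b \<in> H" "\<And>b'. b' \<in> H \<Longrightarrow> exponent_key b \<le> exponent_key b'"
      using FH by (metis arg_min_if_finite(1) arg_min_least)
    have abZ: "a + b \<in> Z_exponents Z" using a b by (auto simp: F_def H_def Z_exponents_def)
    have "Poly_Mapping.lookup (f * h) (a + b) = Poly_Mapping.lookup f a * Poly_Mapping.lookup h b"
    proof (rule coeff_mult_unique)
      fix a' b' assume *: "a' \<in> Poly_Mapping.keys f" "b' \<in> Poly_Mapping.keys h" "a' + b' = a + b"
      \<comment> \<open>Exponents are natural numbers, so a sum vanishes outside \<open>Z\<close>
        only if both summands do; terms of the factors outside K[Z] never contribute to the
        coefficient at \<open>a + b\<close>.\<close>
      have "a' \<in> Z_exponents Z" "b' \<in> Z_exponents Z"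
        using abZ unfolding *(3)[symmetric] by (auto simp: Z_exponents_def)
      then have "exponent_key a \<le> exponent_key a'" "exponent_key b \<le> exponent_key b'"
        using * a b by (auto simp: F_def H_def)
      moreover have "exponent_key a' + exponent_key b' = exponent_key a + exponent_key b"
        using *(3) by (simp flip: exponent_key_add)
      ultimately have "exponent_key a' = exponent_key a \<and> exponent_key b' = exponent_key b"
        by (metis add_le_cancel_left add_le_cancel_right add_mono dual_order.antisym)
      then show "a' = a \<and> b' = b" using inj_exponent_key by (auto dest: injD)
    qed
    moreover have "Poly_Mapping.lookup f a \<noteq> 0" "Poly_Mapping.lookup h b \<noteq> 0"
      using a b by (auto simp: F_def H_def in_keys_iff)
    ultimately have "a + b \<in> Poly_Mapping.keys (f * h)" by (simp add: in_keys_iff)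
    then show False using fh abZ by (auto simp: Z_prime_alt)
  qed
qed

lemma Z_prime_is_monomial_ideal: "\<exists>A. Z_prime Z = monomial_ideal A"
proof -
  have "upset (- Z_exponents Z) = - Z_exponents Z"
    using up_closed_compl_Z_exponents[of Z] by (auto simp: upset_def up_closed_def)
  then show ?thesis by (metis monomial_ideal_eq Z_prime_def)
qed

text \<open>Induction on the total degree: one variable is split off, and primality puts either it
  or the remaining monomial into \<open>P\<close>. Degree 0 cannot occur, as it would give
  \<open>1 \<in> P\<close>.\<close>

lemma is_prime_xpow_variable:
  fixes P :: "('n::finite, 'k::field) mpoly set"
  assumes P: "is_prime P" and "xpow e \<in> P"
  shows "\<exists>j. e j > 0 \<and> xpow (\<lambda>i. if i = j then 1 else 0) \<in> P"
  using assms(2)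
proof (induction "sum e UNIV" arbitrary: e)
  case 0
  then have "e = 0" by (auto simp: fun_eq_iff)
  then have "1 \<in> P" using 0 xpow_0 by metis
  then show ?case using P by (simp add: is_prime_def)
next
  case (Suc m)
  then obtain j where j: "e j > 0" by (metis gr0I sum.neutral nat.distinct(1))
  define x where "x = (\<lambda>i. if i = j then 1 else 0 :: nat)"
  define e' where "e' = e(j := e j - 1)"
  have e: "e = x + e'" using j by (auto simp: x_def e'_def fun_eq_iff)
  then have "xpow e = xpow x * (xpow e' :: ('n, 'k) mpoly)"
    by (simp add: xpow_def mult_single)
  then have "xpow x \<in> P \<or> xpow e' \<in> P" using P Suc.prems by (metis is_prime_def)
  have m: "sum e' UNIV = m"
  proof -
    have "sum e UNIV = sum x UNIV + sum e' UNIV" by (simp add: e sum.distrib)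
    moreover have "sum x UNIV = 1" by (simp add: x_def)
    ultimately show ?thesis using Suc.hyps(2) by simp
  qed
  from \<open>xpow x \<in> P \<or> xpow e' \<in> P\<close> show ?case
  proof
    assume "xpow x \<in> P" then show ?case using j by (auto simp: x_def)
  next
    assume "xpow e' \<in> P"
    then obtain i where "e' i > 0" "xpow (\<lambda>k. if k = i then 1 else 0) \<in> P"
      using Suc.hyps(1) m by blast
    then show ?case using e by (intro exI[of _ i]) auto
  qed
qed

text \<open>\<open>Z\<close> is read off as the set of variables outside \<open>P\<close>. A
  monomial of a prime ideal forces one of its own variables into the ideal, so the variables in
  \<open>P\<close> determine all its exponents.\<close>

lemma monomial_prime_iff:
  fixes P :: "('n::finite, 'k::field) mpoly set"
  shows "monomial_prime P \<longleftrightarrow> (\<exists>Z. P = Z_prime Z)"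
proof
  assume "monomial_prime P"
  then obtain A where P: "is_prime P" and PA: "P = monomial_span (upset A)"
    by (auto simp: monomial_prime_def primeideal_type_ring_iff monomial_ideal_eq)
  define Z where "Z = {j. xpow (\<lambda>i. if i = j then 1 else 0) \<notin> P}"
  have "e \<in> upset A \<longleftrightarrow> e \<notin> Z_exponents Z" for e
  proof
    assume "e \<in> upset A"
    then have "xpow e \<in> P" by (simp add: PA)
    from is_prime_xpow_variable[OF P this] show "e \<notin> Z_exponents Z"
      by (auto simp: Z_def Z_exponents_def)
  next
    assume "e \<notin> Z_exponents Z"
    then obtain j where j: "(\<lambda>i. if i = j then 1 else 0) \<in> upset A" "e j \<noteq> 0"
      by (auto simp: Z_exponents_def Z_def PA)
    then have "(\<lambda>i. if i = j then 1 else 0) \<le> e" by (auto simp: le_fun_def)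
    then show "e \<in> upset A" using j up_closed_upset by (auto simp: up_closed_def)
  qed
  then have "upset A = - Z_exponents Z" by auto
  then show "\<exists>Z. P = Z_prime Z" using PA by (auto simp: Z_prime_def)
next
  assume "\<exists>Z. P = Z_prime Z"
  then show "monomial_prime P"
    using is_prime_Z_prime Z_prime_is_monomial_ideal
    by (auto simp: monomial_prime_def primeideal_type_ring_iff)
qed

subsection \<open>The dimension of a quotient by a monomial prime\<close>

definition power_product :: "'a::comm_ring_1 list \<Rightarrow> nat list \<Rightarrow> 'a"
  where "power_product ys ms = prod_list (map2 (^) ys ms)"

lemma power_product_simps [simp]:
  "power_product [] [] = 1"
  "power_product (y # ys) (m # ms) = y ^ m * power_product ys ms"
  by (simp_all add: power_product_def)

text \<open>A chain of primes together with one witness of strictness per step: \<open>y\<close>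
  lies in the next prime but not in the present one. The later primes stay existentially quantified,
  since the counting argument speaks only of the witnesses.\<close>

fun prime_chain :: "'a::comm_ring_1 set \<Rightarrow> 'a list \<Rightarrow> bool" where
  "prime_chain P [] \<longleftrightarrow> is_prime P"
| "prime_chain P (y # ys) \<longleftrightarrow>
    is_prime P \<and> y \<notin> P \<and> (\<exists>Q. P \<subseteq> Q \<and> y \<in> Q \<and> prime_chain Q ys)"

lemma is_prime_power: "is_prime P \<Longrightarrow> y ^ k \<in> P \<Longrightarrow> y \<in> P"
  by (induction k) (auto simp: is_prime_def)

text \<open>
  After cancelling the least power of the first element \<open>y\<close>, the terms still divisible by \<open>y\<close>
  vanish modulo the next prime of the chain, and the others form a shorter relation.
\<close>

lemma prime_chain_independent:
  assumes "prime_chain P ys" and "finite T" and "\<And>m. m \<in> T \<Longrightarrow> length m = length ys"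
    and "\<And>m. m \<in> T \<Longrightarrow> c m dvd 1" and "(\<Sum>m\<in>T. c m * power_product ys m) \<in> P"
  shows "T = {}"
  using assms
proof (induction ys arbitrary: P T c)
  case Nil
  show ?case
  proof (rule ccontr)
    assume "T \<noteq> {}"
    moreover have "m = []" if "m \<in> T" for m using Nil that by simp
    ultimately have "T = {[]}" by blast
    then have "c [] \<in> P" "c [] dvd 1" using Nil by auto
    then have "1 \<in> P" using Nil.prems(1) by (metis is_prime_def is_idealD(4) dvdE prime_chain.simps(1))
    then show False using Nil.prems(1) by (simp add: is_prime_def)
  qed
next
  case (Cons y ys)
  from Cons.prems(1) obtain Q where P: "is_prime P" "y \<notin> P" and Q: "P \<subseteq> Q" "y \<in> Q" "prime_chain Q ys"
    by auto
  have idQ: "is_ideal Q" using Q(3) by (cases ys) (auto simp: is_prime_def)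
  have pp: "power_product (y # ys) m = y ^ hd m * power_product ys (tl m)" if "m \<in> T" for m
    using Cons.prems(3)[OF that] by (cases m) auto
  show ?case
  proof (rule ccontr)
    assume "T \<noteq> {}"
    define k where "k = Min (hd ` T)"
    define T1 where "T1 = {m \<in> T. hd m = k}"
    have "k \<in> hd ` T" unfolding k_def using \<open>T \<noteq> {}\<close> Cons.prems(2) by (intro Min_in) auto
    then have "T1 \<noteq> {}" by (auto simp: T1_def)
    have k_le: "k \<le> hd m" if "m \<in> T" for m
      unfolding k_def using that Cons.prems(2) by (intro Min_le) auto
    have fin: "finite T1" using Cons.prems(2) by (simp add: T1_def)
    \<comment> \<open>Outside \<open>T1\<close> the exponent of \<open>y\<close> exceeds
      \<open>k\<close>, so the truncated subtraction \<open>hd m - k - 1\<close> is exact; one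
      factor \<open>y\<close> is set aside.\<close>
    define r where "r = (\<Sum>m\<in>T - T1. c m * (y ^ (hd m - k - 1) * power_product ys (tl m)))"
    define s where "s = (\<Sum>m\<in>T1. c m * power_product ys (tl m))"
    have 1: "c m * power_product (y # ys) m = y ^ k * (c m * power_product ys (tl m))" if "m \<in> T1" for m
      using that by (simp add: pp T1_def mult_ac)
    have 2: "c m * power_product (y # ys) m =
        y ^ k * (y * (c m * (y ^ (hd m - k - 1) * power_product ys (tl m))))" if "m \<in> T - T1" for m
    proof -
      have "k < hd m" using k_le[of m] that by (auto simp: T1_def)
      then have "y ^ hd m = y ^ k * (y * y ^ (hd m - k - 1))"
        by (simp flip: power_add power_Suc)
      then show ?thesis using that by (simp add: pp mult_ac)
    qed
    have "(\<Sum>m\<in>T. c m * power_product (y # ys) m) =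
        (\<Sum>m\<in>T - T1. c m * power_product (y # ys) m) + (\<Sum>m\<in>T1. c m * power_product (y # ys) m)"
      using Cons.prems(2) by (intro sum.subset_diff) (auto simp: T1_def)
    also have "\<dots> = y ^ k * (s + y * r)"
      by (simp add: 1 2 r_def s_def sum_distrib_left distrib_left)
    finally have "y ^ k * (s + y * r) \<in> P" using Cons.prems(5) by simp
    \<comment> \<open>\<open>y\<close> is not in \<open>P\<close>, hence neither is
      \<open>y ^ k\<close>, and primality cancels it.\<close>
    then have "s + y * r \<in> P" using P is_prime_power[OF P(1)] unfolding is_prime_def by blast
    then have "s + y * r - y * r \<in> Q"
      using Q(1,2) is_idealD(4,6)[OF idQ] by blast
    then have "s \<in> Q" by simp
    \<comment> \<open>All members of \<open>T1\<close> have head \<open>k\<close>, so passing to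
      tails is injective and yields a relation for the shorter chain.\<close>
    have tl: "k # tl m = m" if "m \<in> T1" for m
      using Cons.prems(3)[of m] that by (cases m) (auto simp: T1_def)
    then have inj: "inj_on tl T1" by (rule inj_on_inverseI)
    have "s = (\<Sum>m\<in>tl ` T1. c (k # m) * power_product ys m)"
      unfolding s_def sum.reindex[OF inj] o_def
      by (intro sum.cong) (simp_all add: tl)
    moreover have "c (k # m) dvd 1" if m: "m \<in> tl ` T1" for m
    proof -
      obtain m' where "m' \<in> T1" "m = tl m'" using m by blast
      then show ?thesis using Cons.prems(4)[of m'] tl[of m'] by (simp add: T1_def)
    qed
    moreover have "length m = length ys" if "m \<in> tl ` T1" for m
      using Cons.prems(3) that by (auto simp: T1_def)
    ultimately have "tl ` T1 = {}"
      using Cons.IH[OF Q(3), of "tl ` T1" "\<lambda>m. c (k # m)"] fin \<open>s \<in> Q\<close> by simp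
    then show False using \<open>T1 \<noteq> {}\<close> by simp
  qed
qed

section \<open>Counting monomials with bounded exponents\<close>

definition exponent_box :: "'n set \<Rightarrow> nat \<Rightarrow> ('n::finite \<Rightarrow> nat) set"
  where "exponent_box Z b = {e \<in> Z_exponents Z. \<forall>j. e j \<le> b}"

lemma exponent_box_mono: "a \<le> b \<Longrightarrow> exponent_box Z a \<subseteq> exponent_box Z b"
  unfolding exponent_box_def by (auto intro: order_trans)

text \<open>Elements vanish outside \<open>Z\<close>, so restriction to \<open>Z\<close> embeds the
  box into a finite function space. Bounding each exponent rather than the total degree makes the
  bound a plain power.\<close>

lemma finite_exponent_box: "finite (exponent_box Z b)"
  and card_exponent_box_le: "card (exponent_box Z b) \<le> (b + 1) ^ card Z"
proof -
  have inj: "inj_on (\<lambda>e. restrict e Z) (exponent_box Z b)"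
  proof (rule inj_onI)
    fix e e' assume *: "e \<in> exponent_box Z b" "e' \<in> exponent_box Z b" "restrict e Z = restrict e' Z"
    show "e = e'"
    proof
      fix j show "e j = e' j"
        using * by (cases "j \<in> Z") (auto simp: exponent_box_def Z_exponents_def dest: fun_cong[of _ _ j])
    qed
  qed
  have sub: "(\<lambda>e. restrict e Z) ` exponent_box Z b \<subseteq> (\<Pi>\<^sub>E j\<in>Z. {..b})"
    by (auto simp: exponent_box_def)
  have fin: "finite (\<Pi>\<^sub>E j\<in>Z. {..b})" by (intro finite_PiE) auto
  show "finite (exponent_box Z b)" using inj sub fin by (meson finite_imageD finite_subset)
  have "card (exponent_box Z b) \<le> card (\<Pi>\<^sub>E j\<in>Z. {..b})"
    using card_inj_on_le[OF inj sub fin] .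
  also have "\<dots> = (b + 1) ^ card Z" by (simp add: card_PiE)
  finally show "card (exponent_box Z b) \<le> (b + 1) ^ card Z" .
qed

lemma monomial_span_box_mult:
  assumes "f \<in> monomial_span (exponent_box Z a)" and "h \<in> monomial_span (exponent_box Z b)"
  shows "f * h \<in> monomial_span (exponent_box Z (a + b))"
proof -
  have "e + e' \<in> exponent_box Z (a + b)" if "e \<in> exponent_box Z a" "e' \<in> exponent_box Z b" for e e'
    using that by (auto simp: exponent_box_def Z_exponents_def add_mono)
  then show ?thesis using assms keys_mult[of f h] unfolding monomial_span_def by fast
qed

lemma one_in_monomial_span_box: "1 \<in> monomial_span (exponent_box Z b)"
  by (simp add: exponent_box_def Z_exponents_def flip: xpow_0)

lemma monomial_span_box_power:
  assumes "f \<in> monomial_span (exponent_box Z a)"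
  shows "f ^ k \<in> monomial_span (exponent_box Z (a * k))"
  by (induction k) (use monomial_span_box_mult[OF assms] one_in_monomial_span_box in auto)

lemma power_product_in_box:
  assumes "length m = length ys" and "set ys \<subseteq> monomial_span (exponent_box Z a)"
  shows "power_product ys m \<in> monomial_span (exponent_box Z (a * sum_list m))"
  using assms
  by (induction m ys rule: list_induct2)
    (auto simp: one_in_monomial_span_box distrib_left intro!: monomial_span_box_mult monomial_span_box_power)

lemma monomial_span_box_exists:
  fixes D :: "('n::finite, 'k::field) mpoly set"
  assumes "finite D" and "D \<subseteq> monomial_span (Z_exponents Z)"
  shows "\<exists>b. D \<subseteq> monomial_span (exponent_box Z b)"
proof -
  define S where "S = (\<lambda>(e, j). e j) ` ((\<Union>f\<in>D. Poly_Mapping.keys f) \<times> (UNIV :: 'n set))"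
  have "finite S" using assms(1) by (simp add: S_def)
  then obtain b where b: "\<forall>x\<in>S. x \<le> b" using finite_nat_set_iff_bounded_le by blast
  have "e j \<le> b" if "f \<in> D" "e \<in> Poly_Mapping.keys f" for f e j
    using b that by (force simp: S_def)
  then have "D \<subseteq> monomial_span (exponent_box Z b)"
    using assms(2) unfolding monomial_span_def exponent_box_def by fast
  then show ?thesis ..
qed

text \<open>Scalars act as constant polynomials. The resulting vector space supplies the bound of an
  independent set by the size of a spanning set, which is the linear algebra behind the dimension
  count.\<close>

definition const_scale :: "'k::field \<Rightarrow> ('n::finite, 'k) mpoly \<Rightarrow> ('n, 'k) mpoly"
  where "const_scale k f = Poly_Mapping.single 0 k * f"

interpretation mpoly_vs: vector_space const_scale
  by unfold_locales
    (simp_all add: const_scale_def distrib_left distrib_right single_add mult_single flip: mult.assoc)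

lemma monomial_span_subset_vs_span:
  "(monomial_span E :: ('n::finite, 'k::field) mpoly set) \<subseteq> mpoly_vs.span (xpow ` E)"
proof
  fix f :: "('n, 'k) mpoly" assume f: "f \<in> monomial_span E"
  have "Poly_Mapping.single e (Poly_Mapping.lookup f e) \<in> mpoly_vs.span (xpow ` E)"
    if "e \<in> Poly_Mapping.keys f" for e
    using f that unfolding single_eq_const_mult_xpow[of e] const_scale_def[symmetric]
    by (intro mpoly_vs.span_scale mpoly_vs.span_base imageI) (auto simp: monomial_span_def)
  then show "f \<in> mpoly_vs.span (xpow ` E)"
    by (subst poly_mapping_sum_single) (rule mpoly_vs.span_sum)
qed

lemma const_dvd_one: "k \<noteq> 0 \<Longrightarrow> (Poly_Mapping.single 0 k :: ('n::finite, 'k::field) mpoly) dvd 1"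
  by (rule dvdI[of _ _ "Poly_Mapping.single 0 (inverse k)"]) (simp add: mult_single)

text \<open>Equal products for different exponent lists would be a relation with coefficients 1 and
  -1; a linear dependence has nonzero constants as coefficients. All of these are units, as
  \<open>prime_chain_independent\<close> demands.\<close>

lemma prime_chain_power_products:
  fixes ys :: "('n::finite, 'k::field) mpoly list"
  assumes "prime_chain P ys"
  shows "inj_on (power_product ys) {m. length m = length ys}"
    and "mpoly_vs.independent (power_product ys ` {m. length m = length ys})"
proof -
  have P0: "0 \<in> P" using assms by (cases ys) (auto simp: is_prime_def is_ideal_def)
  show inj: "inj_on (power_product ys) {m. length m = length ys}"
  proof (rule inj_onI, rule ccontr)
    fix m m' assume *: "m \<in> {m. length m = length ys}" "m' \<in> {m. length m = length ys}"
      "power_product ys m = power_product ys m'" "m \<noteq> m'"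
    define c :: "nat list \<Rightarrow> ('n, 'k) mpoly" where "c = (\<lambda>a. if a = m then 1 else -1)"
    have "(\<Sum>a\<in>{m, m'}. c a * power_product ys a) = 0" using * by (simp add: c_def)
    then have "{m, m'} = {}"
      using * P0 by (intro prime_chain_independent[OF assms, of _ c]) (auto simp: c_def)
    then show False by simp
  qed
  show "mpoly_vs.independent (power_product ys ` {m. length m = length ys})"
  proof
    assume "mpoly_vs.dependent (power_product ys ` {m. length m = length ys})"
    then obtain t u where t: "finite t" "t \<subseteq> power_product ys ` {m. length m = length ys}"
      and u: "(\<Sum>v\<in>t. const_scale (u v) v) = 0" "\<exists>v\<in>t. u v \<noteq> 0"
      unfolding mpoly_vs.dependent_explicit by blast
    \<comment> \<open>Vanishing coefficients are not units, so the dependence is cut down to the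
      vectors with a nonzero coefficient.\<close>
    define t' where "t' = {v \<in> t. u v \<noteq> 0}"
    define T where "T = {m. length m = length ys \<and> power_product ys m \<in> t'}"
    have T: "T \<subseteq> {m. length m = length ys}" "t' = power_product ys ` T"
      using t(2) by (auto simp: T_def t'_def)
    have injT: "inj_on (power_product ys) T" using inj T(1) inj_on_subset by blast
    have "finite t'" using t(1) by (simp add: t'_def)
    then have "finite T" unfolding T(2) using injT by (rule finite_imageD)
    have "0 = (\<Sum>v\<in>t'. const_scale (u v) v)"
      unfolding u(1)[symmetric] t'_def using t(1) by (intro sum.mono_neutral_right) auto
    also have "\<dots> = (\<Sum>m\<in>T. Poly_Mapping.single 0 (u (power_product ys m)) * power_product ys m)"
      unfolding T(2) sum.reindex[OF injT] by (simp add: const_scale_def)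
    finally have "T = {}"
      using \<open>finite T\<close> P0
      by (intro prime_chain_independent[OF assms, of _ "\<lambda>m. Poly_Mapping.single 0 (u (power_product ys m))"])
        (auto simp: T_def t'_def intro!: const_dvd_one)
    then show False using u(2) T(2) by (auto simp: t'_def)
  qed
qed

text \<open>Comparison of growth rates, with r witnesses and z = |Z|: the products with all
  exponents below N are N^r independent polynomials, but their supports stay in a box of size of
  order N^z. For r > z this is impossible once N is large.\<close>

lemma prime_chain_length_le:
  fixes ys :: "('n::finite, 'k::field) mpoly list"
  assumes chain: "prime_chain P ys" and "set ys \<subseteq> monomial_span (Z_exponents Z)"
  shows "length ys \<le> card Z"
proof (rule ccontr)
  define r where "r = length ys"
  define z where "z = card Z"
  assume "\<not> length ys \<le> card Z"
  then have rz: "Suc z \<le> r" by (simp add: r_def z_def)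
  obtain d where d: "set ys \<subseteq> monomial_span (exponent_box Z d)"
    using monomial_span_box_exists[OF _ assms(2)] by auto
  \<comment> \<open>\<open>N\<close> is chosen so that the \<open>N^r\<close> independent products do not fit into the exponent box,
    of size at most \<open>(q * N)^z\<close>, that contains them.\<close>
  define q where "q = d * r + 1"
  define N where "N = q ^ z + 1"
  have N: "q ^ z < N" "0 < N" by (simp_all add: N_def)
  define B where "B = {m. set m \<subseteq> {..<N} \<and> length m = r}"
  have "B \<subseteq> {m. length m = length ys}" by (auto simp: B_def r_def)
  then have inj: "inj_on (power_product ys) B"
    and indep: "mpoly_vs.independent (power_product ys ` B)"
    by (rule inj_on_subset[OF prime_chain_power_products(1)[OF chain]],
      intro mpoly_vs.independent_mono[OF prime_chain_power_products(2)[OF chain]] image_mono)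
  have sum_le: "sum_list m \<le> r * N" if "m \<in> B" for m
  proof -
    have "sum_list (map (\<lambda>x. x) m) \<le> sum_list (map (\<lambda>_. N) m)"
      using that by (intro sum_list_mono) (auto simp: B_def)
    then show ?thesis using that by (simp add: B_def sum_list_triv)
  qed
  have "power_product ys m \<in> monomial_span (exponent_box Z (d * (r * N)))" if "m \<in> B" for m
  proof -
    have "power_product ys m \<in> monomial_span (exponent_box Z (d * sum_list m))"
      using that by (intro power_product_in_box[OF _ d]) (simp add: B_def r_def)
    moreover have "d * sum_list m \<le> d * (r * N)" using sum_le[OF that] by (rule mult_le_mono2)
    ultimately show ?thesis using monomial_span_mono[OF exponent_box_mono] by blast
  qed
  then have "power_product ys ` B \<subseteq> mpoly_vs.span (xpow ` exponent_box Z (d * (r * N)))"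
    by (intro image_subsetI subsetD[OF monomial_span_subset_vs_span])
  then have "card (power_product ys ` B) \<le> card (xpow ` exponent_box Z (d * (r * N)) :: ('n, 'k) mpoly set)"
    by (rule conjunct2[OF mpoly_vs.independent_span_bound[OF finite_imageI[OF finite_exponent_box] indep]])
  also have "\<dots> \<le> (d * (r * N) + 1) ^ z"
    unfolding z_def
    by (rule order_trans[OF card_image_le[OF finite_exponent_box] card_exponent_box_le])
  \<comment> \<open>The summand 1 in \<open>q\<close> absorbs the 1 of the box size, because
    \<open>N \<ge> 1\<close>.\<close>
  also have "\<dots> \<le> (q * N) ^ z"
    using N(2) by (intro power_mono) (simp_all add: q_def algebra_simps)
  also have "\<dots> < N * N ^ z"
    using N by (simp add: power_mult_distrib)
  also have "\<dots> \<le> N ^ r"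
    using power_increasing[OF rz, of N] N(2) by simp
  also have "\<dots> = card (power_product ys ` B)"
    using card_image[OF inj] by (simp add: B_def card_lists_length_eq)
  finally show False by simp
qed

lemma monomial_span_split:
  "\<exists>v \<in> monomial_span E. u - v \<in> monomial_span (- E)"
proof -
  let ?s = "\<lambda>S. \<Sum>e\<in>S. Poly_Mapping.single e (Poly_Mapping.lookup u e)"
  have keys: "Poly_Mapping.keys (?s S) \<subseteq> S" for S
    using keys_sum[of "\<lambda>e. Poly_Mapping.single e (Poly_Mapping.lookup u e)" S] by (auto split: if_splits)
  have "u = ?s (Poly_Mapping.keys u)" by (rule poly_mapping_sum_single)
  also have "\<dots> = ?s (Poly_Mapping.keys u - E) + ?s (Poly_Mapping.keys u \<inter> E)"
    unfolding add.commute[of "?s (Poly_Mapping.keys u - E)"] by (rule sum.Int_Diff) simp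
  finally have "u - ?s (Poly_Mapping.keys u \<inter> E) = ?s (Poly_Mapping.keys u - E)"
    by (rule diff_eq_eq[THEN iffD2])
  then show ?thesis
    using keys[of "Poly_Mapping.keys u \<inter> E"] keys[of "Poly_Mapping.keys u - E"]
    by (intro bexI[of _ "?s (Poly_Mapping.keys u \<inter> E)"]) (auto simp: monomial_span_def)
qed

text \<open>Every polynomial agrees modulo \<open>Z_prime Z\<close> with one in K[Z], and all primes
  of the chain contain \<open>Z_prime Z\<close>. So the witness of each strict inclusion can be
  replaced by its part in K[Z].\<close>

lemma strict_chain_prime_chain:
  fixes P :: "('n::finite, 'k::field) mpoly set"
  assumes "sorted_wrt (\<subset>) (P # Ps)" and "\<forall>Q\<in>set (P # Ps). is_prime Q" and "Z_prime Z \<subseteq> P"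
  shows "\<exists>ys. prime_chain P ys \<and> length ys = length Ps \<and> set ys \<subseteq> monomial_span (Z_exponents Z)"
  using assms
proof (induction Ps arbitrary: P)
  case Nil
  then show ?case by auto
next
  case (Cons Q Ps)
  then have "P \<subset> Q" by simp
  then obtain ys where ys: "prime_chain Q ys" "length ys = length Ps" "set ys \<subseteq> monomial_span (Z_exponents Z)"
    using Cons.IH[of Q] Cons.prems by auto
  obtain u where u: "u \<in> Q" "u \<notin> P" using \<open>P \<subset> Q\<close> by auto
  obtain v where v: "v \<in> monomial_span (Z_exponents Z)" "u - v \<in> Z_prime Z"
    using monomial_span_split[of "Z_exponents Z" u] by (auto simp: Z_prime_def)
  have id: "is_ideal P" "is_ideal Q" using Cons.prems(2) by (auto simp: is_prime_def)
  have "v \<in> Q" "v \<notin> P"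
    using is_ideal_diff_left_iff[OF id(1), of u v] is_ideal_diff_left_iff[OF id(2), of u v]
      u v(2) Cons.prems(3) \<open>P \<subset> Q\<close> by auto
  then have "prime_chain P (v # ys)" using Cons.prems(2) \<open>P \<subset> Q\<close> ys(1) by auto
  then show ?case using ys v(1) by (intro exI[of _ "v # ys"]) auto
qed

section \<open>Prime ideals of a quotient ring\<close>

lemma quot_carrier: "carrier (R Quot P) = (\<lambda>u. P +>\<^bsub>R\<^esub> u) ` carrier R"
  by (auto simp: FactRing_def A_RCOSETS_def' a_r_coset_def')

context
  fixes P :: "'a::comm_ring_1 set"
  assumes P: "is_ideal P"
begin

lemma quot_coset_eq_iff:
  "P +>\<^bsub>ring_of_type_algebra\<^esub> u = P +>\<^bsub>ring_of_type_algebra\<^esub> v \<longleftrightarrow> u - v \<in> P"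
proof -
  have coset: "P +>\<^bsub>ring_of_type_algebra\<^esub> w = {x. x - w \<in> P}" for w
  proof -
    have "x \<in> (\<Union>h\<in>P. {h + w}) \<longleftrightarrow> x - w \<in> P" for x
      by (auto intro!: bexI[of _ "x - w"])
    then show ?thesis by (auto simp: a_r_coset_def')
  qed
  have "x - u \<in> P \<longleftrightarrow> x - v \<in> P" if "u - v \<in> P" for x
    using is_ideal_diff_left_iff[OF P, of "x - v" "x - u"] that by auto
  moreover have "u - u \<in> P" using is_idealD(1)[OF P] by simp
  ultimately show ?thesis unfolding coset by blast
qed

lemma quot_ops:
  "\<one>\<^bsub>ring_of_type_algebra Quot P\<^esub> = P +>\<^bsub>ring_of_type_algebra\<^esub> 1"
  "\<zero>\<^bsub>ring_of_type_algebra Quot P\<^esub> = P +>\<^bsub>ring_of_type_algebra\<^esub> 0"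
  "(P +>\<^bsub>ring_of_type_algebra\<^esub> u) \<oplus>\<^bsub>ring_of_type_algebra Quot P\<^esub> (P +>\<^bsub>ring_of_type_algebra\<^esub> v) =
    P +>\<^bsub>ring_of_type_algebra\<^esub> (u + v)"
  "(P +>\<^bsub>ring_of_type_algebra\<^esub> u) \<otimes>\<^bsub>ring_of_type_algebra Quot P\<^esub> (P +>\<^bsub>ring_of_type_algebra\<^esub> v) =
    P +>\<^bsub>ring_of_type_algebra\<^esub> (u * v)"
proof -
  interpret ideal P "ring_of_type_algebra :: 'a ring" using P ideal_type_ring_iff by blast
  interpret h: ring_hom_ring "ring_of_type_algebra :: 'a ring" "ring_of_type_algebra Quot P"
      "(+>\<^bsub>ring_of_type_algebra\<^esub>) P"
    by (rule rcos_ring_hom_ring)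
  show "\<one>\<^bsub>ring_of_type_algebra Quot P\<^esub> = P +>\<^bsub>ring_of_type_algebra\<^esub> 1"
    using h.hom_one by simp
  show "\<zero>\<^bsub>ring_of_type_algebra Quot P\<^esub> = P +>\<^bsub>ring_of_type_algebra\<^esub> 0"
    using h.hom_zero by simp
  show "(P +>\<^bsub>ring_of_type_algebra\<^esub> u) \<oplus>\<^bsub>ring_of_type_algebra Quot P\<^esub> (P +>\<^bsub>ring_of_type_algebra\<^esub> v) =
    P +>\<^bsub>ring_of_type_algebra\<^esub> (u + v)"
    using h.hom_add[of u v] by simp
  show "(P +>\<^bsub>ring_of_type_algebra\<^esub> u) \<otimes>\<^bsub>ring_of_type_algebra Quot P\<^esub> (P +>\<^bsub>ring_of_type_algebra\<^esub> v) =
    P +>\<^bsub>ring_of_type_algebra\<^esub> (u * v)"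
    using h.hom_mult[of u v] by simp
qed

lemma quot_a_inv:
  "\<ominus>\<^bsub>ring_of_type_algebra Quot P\<^esub> (P +>\<^bsub>ring_of_type_algebra\<^esub> u) = P +>\<^bsub>ring_of_type_algebra\<^esub> (- u)"
proof -
  interpret ideal P "ring_of_type_algebra :: 'a ring" using P ideal_type_ring_iff by blast
  interpret h: ring_hom_ring "ring_of_type_algebra :: 'a ring" "ring_of_type_algebra Quot P"
      "(+>\<^bsub>ring_of_type_algebra\<^esub>) P"
    by (rule rcos_ring_hom_ring)
  show ?thesis using h.hom_a_inv[of u] by (simp add: type_ring_a_inv)
qed

text \<open>Half of the correspondence of primes under the quotient map. The third fact recovers
  \<open>Q\<close> from its preimage; it keeps inclusions strict when a chain is pulled
  back.\<close>

lemma primeideal_quot_preimage: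
  assumes Q: "primeideal Q (ring_of_type_algebra Quot P)"
  shows "is_prime {u. P +>\<^bsub>ring_of_type_algebra\<^esub> u \<in> Q}"
    and "P \<subseteq> {u. P +>\<^bsub>ring_of_type_algebra\<^esub> u \<in> Q}"
    and "Q = (\<lambda>u. P +>\<^bsub>ring_of_type_algebra\<^esub> u) ` {u. P +>\<^bsub>ring_of_type_algebra\<^esub> u \<in> Q}"
proof -
  let ?\<pi> = "\<lambda>u. P +>\<^bsub>ring_of_type_algebra\<^esub> u"
  interpret primeideal Q "ring_of_type_algebra Quot P" by (rule Q)
  have in_carrier: "?\<pi> u \<in> carrier (ring_of_type_algebra Quot P)" for u
    by (auto simp: quot_carrier)
  have 0: "?\<pi> 0 \<in> Q"
    using additive_subgroup.zero_closed[OF is_additive_subgroup] by (simp add: quot_ops)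
  have "?\<pi> u \<in> Q" if "u \<in> P" for u using quot_coset_eq_iff[of u 0] that 0 by simp
  then show "P \<subseteq> {u. ?\<pi> u \<in> Q}" by blast
  show "Q = ?\<pi> ` {u. ?\<pi> u \<in> Q}" using a_subset by (auto simp: quot_carrier)
  have "1 \<notin> {u. ?\<pi> u \<in> Q}"
    using I_notcarr one_imp_carrier by (auto simp: quot_ops)
  moreover have "is_ideal {u. ?\<pi> u \<in> Q}"
    using 0 additive_subgroup.a_closed[OF is_additive_subgroup] I_l_closed in_carrier
    by (auto simp: is_ideal_def simp flip: quot_ops(3,4))
  moreover have "?\<pi> u \<in> Q \<or> ?\<pi> v \<in> Q" if "?\<pi> (u * v) \<in> Q" for u v
    using I_prime[OF in_carrier in_carrier] that by (simp add: quot_ops)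
  ultimately show "is_prime {u. ?\<pi> u \<in> Q}" by (auto simp: is_prime_def)
qed

text \<open>An ideal containing \<open>P\<close> is a union of cosets of \<open>P\<close>, so
  membership can be tested on any representative.\<close>

lemma quot_coset_in_image_iff:
  assumes "is_ideal Q" and "P \<subseteq> Q"
  shows "P +>\<^bsub>ring_of_type_algebra\<^esub> u \<in> (\<lambda>u. P +>\<^bsub>ring_of_type_algebra\<^esub> u) ` Q \<longleftrightarrow> u \<in> Q"
  using assms quot_coset_eq_iff is_ideal_diff_left_iff[OF assms(1)] by blast

lemma primeideal_quot_image:
  assumes Q: "is_prime Q" and "P \<subseteq> Q"
  shows "primeideal ((\<lambda>u. P +>\<^bsub>ring_of_type_algebra\<^esub> u) ` Q) (ring_of_type_algebra Quot P)"
proof -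
  let ?\<pi> = "\<lambda>u. P +>\<^bsub>ring_of_type_algebra\<^esub> u"
  interpret S: cring "ring_of_type_algebra :: 'a ring" by (rule cring_from_type_algebra)
  interpret ideal P "ring_of_type_algebra :: 'a ring" using P ideal_type_ring_iff by blast
  interpret R: cring "ring_of_type_algebra Quot P"
    by (rule quotient_is_cring[OF S.cring_axioms])
  have idQ: "is_ideal Q" using Q by (simp add: is_prime_def)
  note in_iff = quot_coset_in_image_iff[OF idQ \<open>P \<subseteq> Q\<close>]
  have carr: "carrier (ring_of_type_algebra Quot P) = range ?\<pi>" by (simp add: quot_carrier)
  have id: "ideal (?\<pi> ` Q) (ring_of_type_algebra Quot P)"
  proof (rule idealI)
    show "subgroup (?\<pi> ` Q) (add_monoid (ring_of_type_algebra Quot P))"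
      using idQ is_idealD[OF idQ]
      by (intro R.add.subgroupI) (auto simp: carr quot_ops quot_a_inv simp flip: a_inv_def)
  qed (use R.ring_axioms is_idealD[OF idQ] in \<open>auto simp: carr quot_ops\<close>)
  show ?thesis
  proof (rule primeidealI[OF id R.cring_axioms])
    show "carrier (ring_of_type_algebra Quot P) \<noteq> ?\<pi> ` Q"
      using in_iff[of 1] Q by (metis carr is_prime_def rangeI)
    show "a \<in> ?\<pi> ` Q \<or> b \<in> ?\<pi> ` Q"
      if ab: "a \<in> carrier (ring_of_type_algebra Quot P)" "b \<in> carrier (ring_of_type_algebra Quot P)"
        "a \<otimes>\<^bsub>ring_of_type_algebra Quot P\<^esub> b \<in> ?\<pi> ` Q" for a b
    proof -
      obtain u v where uv: "a = ?\<pi> u" "b = ?\<pi> v" using ab by (auto simp: carr)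
      then have "u * v \<in> Q" using ab(3) in_iff by (simp add: quot_ops)
      then show ?thesis using Q by (auto simp: uv is_prime_def)
    qed
  qed
qed

end

lemma Z_prime_strict_antimono:
  assumes "W \<subset> W'"
  shows "Z_prime W' \<subset> (Z_prime W :: ('n::finite, 'k::field) mpoly set)"
proof -
  have "Z_exponents W \<subset> Z_exponents W'"
  proof -
    obtain j where j: "j \<in> W'" "j \<notin> W" using assms by blast
    have "(\<lambda>i. if i = j then 1 else 0) \<in> Z_exponents W' - Z_exponents W"
      using j by (auto simp: Z_exponents_def)
    moreover have "Z_exponents W \<subseteq> Z_exponents W'" using assms by (auto simp: Z_exponents_def)
    ultimately show ?thesis by blast
  qed
  then obtain e where "e \<in> Z_exponents W' - Z_exponents W" "- Z_exponents W' \<subseteq> - Z_exponents W" by blast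
  moreover from this have "xpow e \<in> (Z_prime W :: ('n, 'k) mpoly set)"
    "xpow e \<notin> (Z_prime W' :: ('n, 'k) mpoly set)"
    by (auto simp: Z_prime_def)
  ultimately show ?thesis unfolding Z_prime_def using monomial_span_mono by blast
qed

lemma Z_prime_antimono: "W \<subseteq> W' \<Longrightarrow> Z_prime W' \<subseteq> Z_prime W"
  by (auto simp: Z_prime_alt Z_exponents_def)

text \<open>For the upper bound a chain in the quotient is pulled back to primes above
  \<open>Z_prime Z\<close> and measured by its witnesses. For the lower bound the variables of
  \<open>Z\<close> are added to the ideal one at a time.\<close>

lemma krull_dim_quot_Z_prime:
  "krull_dim ((mpoly_ring :: ('n::finite, 'k::field) mpoly ring) Quot Z_prime Z) = enat (card Z)"
proof -
  let ?P = "Z_prime Z :: ('n, 'k) mpoly set"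
  let ?\<pi> = "\<lambda>u. ?P +>\<^bsub>mpoly_ring\<^esub> u"
  note idP = is_ideal_Z_prime[where 'b = 'k, of Z]
  let ?S = "{enat (length ps - 1) |ps.
      ps \<noteq> [] \<and> (\<forall>Q\<in>set ps. primeideal Q (mpoly_ring Quot ?P)) \<and> sorted_wrt (\<subset>) ps}"
  have "x \<le> enat (card Z)" if x_in: "x \<in> ?S" for x
  proof -
    \<comment> \<open>Separating the first prime makes the length of the chain,
      \<open>length ps - 1\<close>, equal to \<open>length Qs\<close>.\<close>
    obtain Q Qs where x: "x = enat (length Qs)" and prime: "\<forall>Q'\<in>set (Q # Qs). primeideal Q' (mpoly_ring Quot ?P)"
      and sorted: "sorted_wrt (\<subset>) (Q # Qs)"
    proof -
      obtain ps where ps: "x = enat (length ps - 1)" "ps \<noteq> []"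
          "\<forall>Q\<in>set ps. primeideal Q (mpoly_ring Quot ?P)" "sorted_wrt (\<subset>) ps"
        using x_in by blast
      then show ?thesis using that[of "tl ps" "hd ps"] by (cases ps) auto
    qed
    let ?pre = "\<lambda>Q. {u. ?\<pi> u \<in> Q}"
    note pre = primeideal_quot_preimage[OF idP]
    have "sorted_wrt (\<lambda>A B. ?pre A \<subset> ?pre B) (Q # Qs)"
    proof (rule sorted_wrt_mono_rel[OF _ sorted])
      fix A B assume "B \<in> set (Q # Qs)" and AB: "A \<subset> B"
      then have B: "B = ?\<pi> ` ?pre B" using prime by (intro pre(3)) blast
      obtain C where "C \<in> B" "C \<notin> A" using AB by blast
      moreover from this obtain u where "C = ?\<pi> u" using B by (metis imageE)
      ultimately show "?pre A \<subset> ?pre B" using AB by blast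
    qed
    then have "sorted_wrt (\<subset>) (?pre Q # map ?pre Qs)" by (simp add: sorted_wrt_map)
    moreover have "\<forall>A\<in>set (?pre Q # map ?pre Qs). is_prime A" using prime pre(1) by auto
    moreover have "?P \<subseteq> ?pre Q" using prime pre(2) by simp
    ultimately obtain ys where "prime_chain (?pre Q) ys" "length ys = length (map ?pre Qs)"
        "set ys \<subseteq> monomial_span (Z_exponents Z)"
      using strict_chain_prime_chain by blast
    then show ?thesis using prime_chain_length_le x by fastforce
  qed
  moreover have "enat (card Z) \<in> ?S"
  proof -
    obtain zs where zs: "set zs = Z" "distinct zs" using finite_distinct_list[of Z] by auto
    \<comment> \<open>\<open>W i\<close> omits the first \<open>i\<close> variables, so
      \<open>Z_prime (W i)\<close> increases with \<open>i\<close>, from \<open>Z_prime Z\<close> at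
      0 to the ideal of all variables at \<open>length zs\<close>. These are
      \<open>card Z + 1\<close> primes.\<close>
    define W where "W i = set (drop i zs)" for i
    have sub: "?P \<subseteq> Z_prime (W i)" for i
      using zs set_drop_subset[of i zs] by (intro Z_prime_antimono) (auto simp: W_def)
    have W: "W j \<subset> W i" if "i < j" "i < length zs" for i j
    proof -
      have "zs ! i \<in> W i" using that by (simp add: W_def flip: Cons_nth_drop_Suc)
      moreover have "zs ! i \<notin> W j"
        using zs(2) that by (auto simp: W_def in_set_conv_nth nth_eq_iff_index_eq)
      moreover have "W j \<subseteq> W i" using that by (simp add: W_def set_drop_subset_set_drop)
      ultimately show ?thesis by blast
    qed
    define ps where "ps = map (\<lambda>i. ?\<pi> ` Z_prime (W i)) [0..<Suc (length zs)]"
    have "sorted_wrt (\<subset>) ps"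
      unfolding ps_def sorted_wrt_map
    proof (rule sorted_wrt_mono_rel[OF _ sorted_wrt_upt])
      fix i j assume *: "i \<in> set [0..<Suc (length zs)]" "j \<in> set [0..<Suc (length zs)]" "i < j"
      then have strict: "Z_prime (W i) \<subset> (Z_prime (W j) :: ('n, 'k) mpoly set)"
        by (intro Z_prime_strict_antimono W) auto
      then obtain u where "u \<in> (Z_prime (W j) :: ('n, 'k) mpoly set)" "u \<notin> Z_prime (W i)" by blast
      then have "?\<pi> u \<in> ?\<pi> ` Z_prime (W j)" "?\<pi> u \<notin> ?\<pi> ` Z_prime (W i)"
        using quot_coset_in_image_iff[OF idP is_ideal_Z_prime sub] by blast+
      then show "?\<pi> ` Z_prime (W i) \<subset> ?\<pi> ` Z_prime (W j)" using strict by blast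
    qed
    moreover have "\<forall>Q\<in>set ps. primeideal Q (mpoly_ring Quot ?P)"
      using primeideal_quot_image[OF idP is_prime_Z_prime sub] by (auto simp: ps_def)
    moreover have "ps \<noteq> []" "length ps - 1 = card Z" using zs distinct_card[of zs] by (auto simp: ps_def)
    ultimately show ?thesis unfolding mem_Collect_eq by (intro exI[of _ ps]) simp
  qed
  ultimately show ?thesis unfolding krull_dim_def by (intro antisym Sup_least Sup_upper)
qed

subsection \<open>Graded modules presented by ideals\<close>

text \<open>Exponents are natural but degrees are integral: in a degree with a negative entry only 0
  is left.\<close>

definition deg_part :: "('n \<Rightarrow> int) \<Rightarrow> ('n::finite, 'k::field) mpoly set"
  where "deg_part d = {f. \<forall>e\<in>Poly_Mapping.keys f. \<forall>j. int (e j) = d j}"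

lemma deg_part_single:
  assumes "f \<in> deg_part d" and "e \<in> Poly_Mapping.keys f"
  shows "f = Poly_Mapping.single e (Poly_Mapping.lookup f e)"
proof -
  have "e' = e" if "e' \<in> Poly_Mapping.keys f" for e'
  proof
    fix j
    have "int (e' j) = int (e j)" using assms that by (simp add: deg_part_def)
    then show "e' j = e j" by simp
  qed
  then have "Poly_Mapping.keys f = {e}" using assms(2) by blast
  then show ?thesis using poly_mapping_sum_single[of f] by simp
qed

text \<open>
  Subquotients of \<open>S\<close>, subquotients of these, and so on have cosets of cosets as elements. All of
  them are handled through a coset map \<open>\<alpha>\<close> that identifies them with \<open>L / K\<close> for ideals \<open>K \<subseteq> L\<close>.
\<close>

locale presentation =
  fixes M :: "(('n::finite, 'k::field) mpoly, 'm, 'n) gr_module"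
    and L K :: "('n, 'k) mpoly set" and \<alpha> :: "('n, 'k) mpoly \<Rightarrow> 'm"
  assumes ideal_L: "is_ideal L" and ideal_K: "is_ideal K" and K_le_L: "K \<subseteq> L"
    and carrier_eq: "carrier M = \<alpha> ` L"
    and zero_eq: "\<zero>\<^bsub>M\<^esub> = \<alpha> 0"
    and add_eq: "u \<in> L \<Longrightarrow> v \<in> L \<Longrightarrow> \<alpha> u \<oplus>\<^bsub>M\<^esub> \<alpha> v = \<alpha> (u + v)"
    and smult_eq: "u \<in> L \<Longrightarrow> s \<odot>\<^bsub>M\<^esub> \<alpha> u = \<alpha> (s * u)"
    and eq_iff: "u \<in> L \<Longrightarrow> v \<in> L \<Longrightarrow> \<alpha> u = \<alpha> v \<longleftrightarrow> u - v \<in> K"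
    and hcomp_eq: "hcomp M d = \<alpha> ` (L \<inter> deg_part d)"

lemma presentation_mpoly_module: "presentation mpoly_module UNIV {0} (\<lambda>u. u)"
  by unfold_locales (auto simp: is_ideal_def mpoly_module_def deg_part_def)

context presentation
begin

lemma coset_eq:
  assumes "is_ideal E" and "E \<subseteq> L" and "u \<in> L"
  shows "\<alpha> ` E +>\<^bsub>M\<^esub> \<alpha> u = \<alpha> ` {w. w - u \<in> E}"
proof -
  have "\<alpha> ` E +>\<^bsub>M\<^esub> \<alpha> u = (\<Union>w\<in>E. {\<alpha> w \<oplus>\<^bsub>M\<^esub> \<alpha> u})"
    by (simp add: a_r_coset_def')
  also have "\<dots> = (\<Union>w\<in>E. {\<alpha> (w + u)})"
    using assms(2,3) by (intro SUP_cong) (auto simp: add_eq subset_iff)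
  also have "\<dots> = \<alpha> ` {w. w - u \<in> E}"
  proof -
    have "{w. w - u \<in> E} = (\<lambda>w. w + u) ` E" by (auto intro!: image_eqI[of _ _ "_ - u"])
    then show ?thesis by auto
  qed
  finally show ?thesis .
qed

text \<open>The third isomorphism theorem in this setting: (F/K)/(E/K) is presented by F and E
  again. As the result has the same shape, the step can be iterated.\<close>

lemma presentation_gr_quot:
  assumes E: "is_ideal E" and F: "is_ideal F" and "K \<subseteq> E" "E \<subseteq> F" "F \<subseteq> L"
  shows "presentation (gr_quot M (\<alpha> ` F) (\<alpha> ` E)) F E (\<lambda>u. \<alpha> ` E +>\<^bsub>M\<^esub> \<alpha> u)"
proof -
  note L = is_idealD[OF ideal_L] and E' = is_idealD[OF E] and F' = is_idealD[OF F]
  have EL: "E \<subseteq> L" using assms by auto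
  note coset = coset_eq[OF E EL]
  have coset_sub: "w \<in> L" if "w - u \<in> E" "u \<in> L" for w u
    using is_ideal_diff_left_iff[OF ideal_L, of w u] that EL by auto
  show ?thesis
  proof
    show "is_ideal F" "is_ideal E" "E \<subseteq> F" by fact+
    show "carrier (gr_quot M (\<alpha> ` F) (\<alpha> ` E)) = (\<lambda>u. \<alpha> ` E +>\<^bsub>M\<^esub> \<alpha> u) ` F"
      by (simp add: gr_quot_def image_image)
    show "\<zero>\<^bsub>gr_quot M (\<alpha> ` F) (\<alpha> ` E)\<^esub> = \<alpha> ` E +>\<^bsub>M\<^esub> \<alpha> 0"
      using coset[OF L(1)] by (simp add: gr_quot_def)
  next
    fix u v assume "u \<in> F" "v \<in> F"
    then have uv: "u \<in> L" "v \<in> L" using assms by auto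
    have "set_add M (\<alpha> ` {w. w - u \<in> E}) (\<alpha> ` {w. w - v \<in> E}) = \<alpha> ` {w. w - (u + v) \<in> E}"
    proof -
      have sum_in: "\<alpha> w \<oplus>\<^bsub>M\<^esub> \<alpha> w' \<in> \<alpha> ` {w. w - (u + v) \<in> E}" if "w - u \<in> E" "w' - v \<in> E" for w w'
      proof -
        have "\<alpha> w \<oplus>\<^bsub>M\<^esub> \<alpha> w' = \<alpha> (w + w')" using coset_sub uv that by (intro add_eq)
        moreover have "w + w' - (u + v) \<in> E" using E'(2)[OF that] by (simp add: algebra_simps)
        ultimately show ?thesis by blast
      qed
      have in_sum: "\<exists>w'\<in>{w. w - u \<in> E}. \<exists>w''\<in>{w. w - v \<in> E}. \<alpha> w = \<alpha> w' \<oplus>\<^bsub>M\<^esub> \<alpha> w''"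
        if "w - (u + v) \<in> E" for w
      proof -
        have "w - v - u \<in> E" "v - v \<in> E" using that E'(1) by (simp_all add: algebra_simps)
        moreover from this have "\<alpha> w = \<alpha> (w - v) \<oplus>\<^bsub>M\<^esub> \<alpha> v"
          using coset_sub uv by (simp add: add_eq)
        ultimately show ?thesis by (intro bexI[of _ "w - v"] bexI[of _ v]) auto
      qed
      show ?thesis
        unfolding set_add_def'
      proof (intro subset_antisym subsetI)
        fix x assume "x \<in> (\<Union>h\<in>\<alpha> ` {w. w - u \<in> E}. \<Union>k\<in>\<alpha> ` {w. w - v \<in> E}. {h \<oplus>\<^bsub>M\<^esub> k})"
        then obtain w w' where "w - u \<in> E" "w' - v \<in> E" "x = \<alpha> w \<oplus>\<^bsub>M\<^esub> \<alpha> w'" by auto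
        then show "x \<in> \<alpha> ` {w. w - (u + v) \<in> E}" using sum_in by simp
      next
        fix x assume "x \<in> \<alpha> ` {w. w - (u + v) \<in> E}"
        then obtain w where w: "w - (u + v) \<in> E" "x = \<alpha> w" by auto
        from in_sum[OF w(1)] show "x \<in> (\<Union>h\<in>\<alpha> ` {w. w - u \<in> E}. \<Union>k\<in>\<alpha> ` {w. w - v \<in> E}. {h \<oplus>\<^bsub>M\<^esub> k})"
          using w(2) by auto
      qed
    qed
    then show "(\<alpha> ` E +>\<^bsub>M\<^esub> \<alpha> u) \<oplus>\<^bsub>gr_quot M (\<alpha> ` F) (\<alpha> ` E)\<^esub> (\<alpha> ` E +>\<^bsub>M\<^esub> \<alpha> v) = \<alpha> ` E +>\<^bsub>M\<^esub> \<alpha> (u + v)"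
      using uv L(2) by (simp add: gr_quot_def coset)
    show "(\<alpha> ` E +>\<^bsub>M\<^esub> \<alpha> u) = (\<alpha> ` E +>\<^bsub>M\<^esub> \<alpha> v) \<longleftrightarrow> u - v \<in> E"
    proof
      assume "\<alpha> ` E +>\<^bsub>M\<^esub> \<alpha> u = \<alpha> ` E +>\<^bsub>M\<^esub> \<alpha> v"
      then have "\<alpha> u \<in> \<alpha> ` {w. w - v \<in> E}" using uv E'(1) by (auto simp: coset)
      then obtain w where w: "w - v \<in> E" "\<alpha> u = \<alpha> w" by blast
      then have "u - w \<in> E" using eq_iff uv coset_sub assms(3) by blast
      then have "(u - w) + (w - v) \<in> E" using w E'(2) by blast
      then show "u - v \<in> E" by simp
    next
      assume "u - v \<in> E"
      then have "w - u \<in> E \<longleftrightarrow> w - v \<in> E" for w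
        using is_ideal_diff_left_iff[OF E, of "w - v" "w - u"] by simp
      then show "\<alpha> ` E +>\<^bsub>M\<^esub> \<alpha> u = \<alpha> ` E +>\<^bsub>M\<^esub> \<alpha> v" using uv by (simp add: coset)
    qed
  next
    fix u s assume "u \<in> F"
    then have u: "u \<in> L" using assms by auto
    have "{(s \<odot>\<^bsub>M\<^esub> a) \<oplus>\<^bsub>M\<^esub> b |a b. a \<in> \<alpha> ` {w. w - u \<in> E} \<and> b \<in> \<alpha> ` E} = \<alpha> ` {w. w - s * u \<in> E}"
    proof -
      have comb_in: "(s \<odot>\<^bsub>M\<^esub> \<alpha> w) \<oplus>\<^bsub>M\<^esub> \<alpha> x \<in> \<alpha> ` {w. w - s * u \<in> E}" if "w - u \<in> E" "x \<in> E" for w x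
      proof -
        have "w \<in> L" using coset_sub u that by blast
        then have "(s \<odot>\<^bsub>M\<^esub> \<alpha> w) \<oplus>\<^bsub>M\<^esub> \<alpha> x = \<alpha> (s * w + x)"
          using that EL L(3) by (simp add: smult_eq add_eq subset_iff)
        moreover have "s * (w - u) + x \<in> E" using that E' by blast
        then have "s * w + x - s * u \<in> E" by (simp add: algebra_simps)
        ultimately show ?thesis by blast
      qed
      have in_comb: "\<exists>a b. \<alpha> w = (s \<odot>\<^bsub>M\<^esub> a) \<oplus>\<^bsub>M\<^esub> b \<and> a \<in> \<alpha> ` {w. w - u \<in> E} \<and> b \<in> \<alpha> ` E"
        if "w - s * u \<in> E" for w
      proof -
        have "\<alpha> w = (s \<odot>\<^bsub>M\<^esub> \<alpha> u) \<oplus>\<^bsub>M\<^esub> \<alpha> (w - s * u)"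
          using u that EL L(3) by (simp add: smult_eq add_eq subset_iff)
        moreover have "u - u \<in> E" using E'(1) by simp
        ultimately show ?thesis using that by (intro exI[of _ "\<alpha> u"] exI[of _ "\<alpha> (w - s * u)"]) simp
      qed
      show ?thesis
      proof (intro subset_antisym subsetI)
        fix x assume "x \<in> {(s \<odot>\<^bsub>M\<^esub> a) \<oplus>\<^bsub>M\<^esub> b |a b. a \<in> \<alpha> ` {w. w - u \<in> E} \<and> b \<in> \<alpha> ` E}"
        then obtain w y where "w - u \<in> E" "y \<in> E" "x = (s \<odot>\<^bsub>M\<^esub> \<alpha> w) \<oplus>\<^bsub>M\<^esub> \<alpha> y" by auto
        then show "x \<in> \<alpha> ` {w. w - s * u \<in> E}" using comb_in by simp
      next
        fix x assume "x \<in> \<alpha> ` {w. w - s * u \<in> E}"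
        then obtain w where w: "w - s * u \<in> E" "x = \<alpha> w" by auto
        from in_comb[OF w(1)] show "x \<in> {(s \<odot>\<^bsub>M\<^esub> a) \<oplus>\<^bsub>M\<^esub> b |a b. a \<in> \<alpha> ` {w. w - u \<in> E} \<and> b \<in> \<alpha> ` E}"
          unfolding w(2) mem_Collect_eq .
      qed
    qed
    then show "s \<odot>\<^bsub>gr_quot M (\<alpha> ` F) (\<alpha> ` E)\<^esub> (\<alpha> ` E +>\<^bsub>M\<^esub> \<alpha> u) = \<alpha> ` E +>\<^bsub>M\<^esub> \<alpha> (s * u)"
      using u L(3) by (simp add: gr_quot_def coset)
  next
    fix d
    \<comment> \<open>Representatives are unique modulo \<open>K\<close>, which lies in
      \<open>F\<close>; hence a homogeneous representative in \<open>L\<close> of an element of the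
      image of \<open>F\<close> is itself in \<open>F\<close>.\<close>
    have "\<alpha> ` F \<inter> \<alpha> ` (L \<inter> deg_part d) = \<alpha> ` (F \<inter> deg_part d)"
    proof -
      have "v \<in> F" if "u \<in> F" "v \<in> L" "\<alpha> u = \<alpha> v" for u v
      proof -
        have "u - v \<in> F" using that assms eq_iff by blast
        then show ?thesis using is_ideal_diff_left_iff[OF F] that(1) by blast
      qed
      then show ?thesis using assms by blast
    qed
    then show "hcomp (gr_quot M (\<alpha> ` F) (\<alpha> ` E)) d = (\<lambda>u. \<alpha> ` E +>\<^bsub>M\<^esub> \<alpha> u) ` (F \<inter> deg_part d)"
      by (simp add: gr_quot_def hcomp_eq image_image)
  qed
qed

lemma abelian_group_M: "abelian_group M"
proof (rule abelian_groupI)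
  fix x assume "x \<in> carrier M"
  then obtain u where u: "u \<in> L" "x = \<alpha> u" by (auto simp: carrier_eq)
  then have "\<alpha> (- u) \<oplus>\<^bsub>M\<^esub> x = \<zero>\<^bsub>M\<^esub>" using is_idealD[OF ideal_L] by (simp add: add_eq zero_eq)
  then show "\<exists>y\<in>carrier M. y \<oplus>\<^bsub>M\<^esub> x = \<zero>\<^bsub>M\<^esub>"
    using u is_idealD(5)[OF ideal_L] by (auto simp: carrier_eq)
qed (use is_idealD[OF ideal_L] in \<open>auto simp: carrier_eq zero_eq add_eq algebra_simps\<close>)

lemma finsum_eq:
  assumes "finite D" and "\<And>d. d \<in> D \<Longrightarrow> w d \<in> L"
  shows "finsum M (\<lambda>d. \<alpha> (w d)) D = \<alpha> (sum w D)"
proof -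
  interpret abelian_group M by (rule abelian_group_M)
  show ?thesis using assms
  proof (induction D)
    case empty
    then show ?case by (simp add: zero_eq)
  next
    case (insert d D)
    then have "sum w D \<in> L" using is_ideal_sum[OF ideal_L, of D w] by auto
    then show ?case using insert by (subst finsum_insert) (auto simp: carrier_eq add_eq)
  qed
qed

section \<open>Graded submodules as images of monomial spans\<close>

lemma submodule_image:
  assumes "is_ideal E" and "E \<subseteq> L"
  shows "submodule (\<alpha> ` E) mpoly_ring M"
proof -
  interpret abelian_group M by (rule abelian_group_M)
  note E' = is_idealD[OF assms(1)]
  have inv: "\<ominus>\<^bsub>M\<^esub> \<alpha> u = \<alpha> (- u)" if "u \<in> E" for u
    using that E'(5)[OF that] assms(2)
    by (intro minus_equality) (auto simp: carrier_eq zero_eq add_eq subset_iff)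
  show ?thesis
  proof (intro submodule.intro submodule_axioms.intro)
    show "subgroup (\<alpha> ` E) (add_monoid M)"
      using E' assms(2) inv
      by (intro add.subgroupI) (auto simp: carrier_eq add_eq subset_iff simp flip: a_inv_def)
    show "a \<odot>\<^bsub>M\<^esub> x \<in> \<alpha> ` E" if "x \<in> \<alpha> ` E" for a x
      using that E'(3) assms(2) by (auto simp: smult_eq subset_iff)
  qed
qed

lemma gr_submodule_monomial_span:
  assumes E: "up_closed E" and EL: "monomial_span E \<subseteq> L"
  shows "gr_submodule (\<alpha> ` monomial_span E) M"
  unfolding gr_submodule_def
proof (intro conjI ballI)
  show "submodule (\<alpha> ` monomial_span E) mpoly_ring M"
    by (rule submodule_image[OF is_ideal_monomial_span[OF E] EL])
next
  fix x assume "x \<in> \<alpha> ` monomial_span E"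
  then obtain u where u: "u \<in> monomial_span E" "x = \<alpha> u" by blast
  \<comment> \<open>The homogeneous component of \<open>u\<close> of degree \<open>d\<close>. On
    \<open>D\<close> the map \<open>nat\<close> recovers the exponent from the degree.\<close>
  define w where "w d = (let e = (\<lambda>j. nat (d j)) in Poly_Mapping.single e (Poly_Mapping.lookup u e))"
    for d :: "'n \<Rightarrow> int"
  define D where "D = (\<lambda>e j. int (e j)) ` Poly_Mapping.keys u"
  have inj: "inj_on (\<lambda>e j. int (e j)) (Poly_Mapping.keys u)" by (auto simp: inj_on_def fun_eq_iff)
  have fin: "finite D" by (simp add: D_def)
  have "sum w D = (\<Sum>e\<in>Poly_Mapping.keys u. Poly_Mapping.single e (Poly_Mapping.lookup u e))"
    unfolding D_def sum.reindex[OF inj] by (simp add: w_def)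
  then have sum: "sum w D = u" using poly_mapping_sum_single[of u] by simp
  have w: "w d \<in> monomial_span E \<inter> deg_part d" if "d \<in> D" for d
    using that u(1) by (auto simp: D_def w_def monomial_span_def deg_part_def split: if_splits)
  have "finsum M (\<lambda>d. \<alpha> (w d)) D = \<alpha> (sum w D)"
    by (rule finsum_eq[OF fin]) (use w EL in blast)
  then have "x = finsum M (\<lambda>d. \<alpha> (w d)) D"
    using u(2) sum by simp
  moreover have "\<forall>d\<in>D. \<alpha> (w d) \<in> \<alpha> ` monomial_span E \<inter> hcomp M d"
    using w EL by (auto simp: hcomp_eq)
  ultimately show "\<exists>D v. finite D \<and> (\<forall>d\<in>D. v d \<in> \<alpha> ` monomial_span E \<inter> hcomp M d) \<and> x = finsum M v D"
    using fin by (intro exI[of _ D] exI[of _ "\<lambda>d. \<alpha> (w d)"] conjI)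
qed

text \<open>The preimage \<open>U\<close> of \<open>N\<close> in \<open>L\<close> is an ideal
  containing \<open>K\<close>. The grading splits each of its elements, modulo \<open>K\<close>,
  into homogeneous elements of \<open>U\<close>, and those are scalar multiples of monomials; hence
  \<open>U\<close> is spanned by the monomials that it contains.\<close>

lemma gr_submodule_imp_monomial_span:
  assumes N: "gr_submodule N M" and K: "K = monomial_span E0"
  shows "\<exists>E. up_closed E \<and> E0 \<subseteq> E \<and> monomial_span E \<subseteq> L \<and> N = \<alpha> ` monomial_span E"
proof -
  interpret submodule N mpoly_ring M using N by (simp add: gr_submodule_def)
  define U where "U = {u \<in> L. \<alpha> u \<in> N}"
  define E where "E = {e. xpow e \<in> U}"
  have NU: "N = \<alpha> ` U" using subset by (auto simp: U_def carrier_eq)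
  have idU: "is_ideal U"
    unfolding is_ideal_def
  proof (intro conjI ballI allI)
    show "0 \<in> U" using one_closed is_idealD[OF ideal_L] by (simp add: U_def zero_eq)
    show "u + v \<in> U" if "u \<in> U" "v \<in> U" for u v
      using that m_closed[of "\<alpha> u" "\<alpha> v"] is_idealD[OF ideal_L] by (simp add: U_def add_eq)
    show "s * u \<in> U" if "u \<in> U" for s u
      using that smult_closed[of s "\<alpha> u"] is_idealD[OF ideal_L] by (simp add: U_def smult_eq)
  qed
  have KU: "K \<subseteq> U"
  proof
    fix u assume "u \<in> K"
    then have "\<alpha> u = \<alpha> 0" "u \<in> L" using K_le_L eq_iff is_idealD(1)[OF ideal_L] by auto
    then show "u \<in> U" using one_closed by (simp add: U_def zero_eq)
  qed
  have up: "up_closed E"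
    unfolding up_closed_def
  proof (intro ballI allI impI)
    fix a b assume "a \<in> E" "a \<le> b"
    then obtain c where "xpow a \<in> U" "b = a + c" by (auto simp: E_def exponent_le_iff_add)
    moreover have "xpow (a + c) = xpow a * (xpow c :: ('n, 'k) mpoly)" by (simp add: xpow_def mult_single)
    ultimately show "b \<in> E" using is_idealD(4)[OF idU] by (simp add: E_def)
  qed
  have "U \<subseteq> monomial_span E"
  proof
    fix u assume u: "u \<in> U"
    then have "\<alpha> u \<in> N" by (simp add: U_def)
    then obtain D v where D: "finite D" "\<forall>d\<in>D. v d \<in> N \<inter> hcomp M d" "\<alpha> u = finsum M v D"
      using N unfolding gr_submodule_def by blast
    have "\<exists>w. w \<in> L \<inter> deg_part d \<and> v d = \<alpha> w" if "d \<in> D" for d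
      using D(2) that unfolding hcomp_eq by blast
    then obtain w where w: "\<And>d. d \<in> D \<Longrightarrow> w d \<in> L \<inter> deg_part d \<and> v d = \<alpha> (w d)" by metis
    have wE: "w d \<in> monomial_span E" if "d \<in> D" for d
    proof -
      have wU: "w d \<in> U" using w[OF that] D(2) that by (auto simp: U_def)
      have "e \<in> E" if e: "e \<in> Poly_Mapping.keys (w d)" for e
      proof -
        have "w d = Poly_Mapping.single e (Poly_Mapping.lookup (w d) e)"
          using w[OF \<open>d \<in> D\<close>] e by (intro deg_part_single) auto
        \<comment> \<open>Dividing by the nonzero coefficient turns the homogeneous element into a
          monomial of \<open>U\<close>.\<close>
        then have "Poly_Mapping.single 0 (inverse (Poly_Mapping.lookup (w d) e)) * w d = xpow e"
          using e by (subst (asm) in_keys_iff) (metis add.left_neutral left_inverse mult_single xpow_def)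
        then show ?thesis using is_idealD(3)[OF idU wU] by (metis E_def mem_Collect_eq)
      qed
      then show ?thesis by (auto simp: monomial_span_def)
    qed
    have idE: "is_ideal (monomial_span E :: ('n, 'k) mpoly set)" by (rule is_ideal_monomial_span[OF up])
    have "finsum M v D = finsum M (\<lambda>d. \<alpha> (w d)) D"
      using w by (intro abelian_monoid.finsum_cong'[OF abelian_group.axioms(1)[OF abelian_group_M]])
        (auto simp: carrier_eq)
    also have "\<dots> = \<alpha> (sum w D)" using w by (intro finsum_eq[OF D(1)]) auto
    finally have "u - sum w D \<in> K"
      using D(3) u w eq_iff is_ideal_sum[OF ideal_L, of D w] by (auto simp: U_def)
    \<comment> \<open>Since \<open>K\<close> is itself a monomial span, all exponents of an element
      of \<open>K\<close> belong to \<open>E0\<close>, hence to \<open>E\<close>.\<close>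
    then have "u - sum w D \<in> monomial_span E"
      using KU unfolding K by (auto simp: monomial_span_def E_def subset_iff) (metis (no_types, lifting) xpow_in_monomial_span monomial_span_def mem_Collect_eq subsetD)
    moreover have "sum w D \<in> monomial_span E" using wE by (rule is_ideal_sum[OF idE])
    ultimately show "u \<in> monomial_span E" using is_ideal_diff_left_iff[OF idE] by blast
  qed
  moreover have "monomial_span E \<subseteq> U"
    by (rule monomial_span_subset_ideal[OF idU]) (simp add: E_def)
  ultimately have "U = monomial_span E" by blast
  moreover have "E0 \<subseteq> E" using KU unfolding K E_def by (auto simp: subset_iff)
  moreover have "U \<subseteq> L" by (auto simp: U_def)
  ultimately show ?thesis using up NU by (intro exI[of _ E]) simp
qed

end

subsection \<open>Cones of exponents and shifted quotients by monomial primes\<close>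

text \<open>The exponents of the monomials that span the Stanley space x^c K[Z].\<close>

definition stanley_set :: "('n \<Rightarrow> nat) \<Rightarrow> 'n set \<Rightarrow> ('n \<Rightarrow> nat) set"
  where "stanley_set c Z = {e. c \<le> e \<and> (\<forall>j. j \<notin> Z \<longrightarrow> e j = c j)}"

lemma stanley_set_eq: "stanley_set c Z = (+) c ` Z_exponents Z"
proof
  show "stanley_set c Z \<subseteq> (+) c ` Z_exponents Z"
    by (auto simp: stanley_set_def Z_exponents_def exponent_le_iff_add)
  show "(+) c ` Z_exponents Z \<subseteq> stanley_set c Z"
    by (auto simp: stanley_set_def Z_exponents_def le_fun_def)
qed

lemma add_in_stanley_set_iff: "c + e \<in> stanley_set c Z \<longleftrightarrow> e \<in> Z_exponents Z"
  by (auto simp: stanley_set_def Z_exponents_def le_fun_def)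

lemma gr_shift_simps [simp]:
  "carrier (gr_shift M a) = carrier M" "ring.add (gr_shift M a) = ring.add M"
  "module.smult (gr_shift M a) = module.smult M"
  "hcomp (gr_shift M a) d = hcomp M (a + d)"
  by (simp_all add: gr_shift_def)

lemma keys_xpow_mult:
  fixes f :: "('n::finite, 'k::field) mpoly"
  shows "Poly_Mapping.keys (xpow c * f) = (+) c ` Poly_Mapping.keys f"
proof -
  have coeff: "Poly_Mapping.lookup (xpow c * f) (c + e) = Poly_Mapping.lookup f e" for e
  proof -
    have "Poly_Mapping.lookup (xpow c * f) (c + e) = Poly_Mapping.lookup (xpow c) c * Poly_Mapping.lookup f e"
      by (rule coeff_mult_unique) (simp_all add: xpow_def)
    then show ?thesis by (simp add: xpow_def)
  qed
  have "Poly_Mapping.keys (xpow c * f) \<subseteq> (+) c ` Poly_Mapping.keys f"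
    using keys_mult[of "xpow c" f] by (auto simp: xpow_def)
  moreover have "(+) c ` Poly_Mapping.keys f \<subseteq> Poly_Mapping.keys (xpow c * f)"
    by (auto simp: in_keys_iff coeff)
  ultimately show ?thesis by (rule subset_antisym)
qed

text \<open>Multiplication by x^c carries S into the numerator, and a multiple falls into the
  denominator exactly when the cofactor is in \<open>Z_prime Z\<close>. It is onto modulo the
  denominator because every exponent of \<open>F - E\<close> lies in the cone. The isomorphism
  constructed is its inverse, division by x^c.\<close>

lemma gr_iso_stanley_set:
  fixes M :: "(('n::finite, 'k::field) mpoly, 'm, 'n) gr_module"
    and Q :: "(('n, 'k) mpoly, 'l, 'n) gr_module"
  assumes M: "presentation M (monomial_span F) (monomial_span E) \<alpha>"
    and Q: "presentation Q UNIV (Z_prime Z) \<beta>"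
    and EF: "up_closed F" "F - E = stanley_set c Z"
  shows "gr_iso M (gr_shift Q (- (\<lambda>j. int (c j))))"
proof -
  interpret M: presentation M "monomial_span F" "monomial_span E" \<alpha> by (rule M)
  interpret Q: presentation Q UNIV "Z_prime Z" \<beta> by (rule Q)
  note L' = is_idealD[OF M.ideal_L] and K' = is_idealD[OF M.ideal_K]
  have "c \<in> F" using EF(2) by (auto simp: stanley_set_def)
  then have mult_F: "xpow c * f \<in> monomial_span F" for f :: "('n, 'k) mpoly"
    using L'(4)[of "xpow c" f] by simp
  have mult_E: "xpow c * f \<in> monomial_span E \<longleftrightarrow> f \<in> Z_prime Z" for f :: "('n, 'k) mpoly"
  proof -
    have "c + e \<in> E \<longleftrightarrow> e \<notin> Z_exponents Z" for e
    proof -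
      have "c + e \<in> F" using EF(1) \<open>c \<in> F\<close> by (auto simp: up_closed_def le_fun_def)
      then show ?thesis using EF(2) add_in_stanley_set_iff[of c e Z] by blast
    qed
    then show ?thesis by (auto simp: Z_prime_alt monomial_span_def keys_xpow_mult)
  qed
  have quotient: "\<exists>f. u - xpow c * f \<in> monomial_span E \<and> (\<forall>d. u \<in> deg_part d \<longrightarrow> f \<in> deg_part (- (\<lambda>j. int (c j)) + d))"
    if u: "u \<in> monomial_span F" for u :: "('n, 'k) mpoly"
  proof -
    \<comment> \<open>Terms with exponent in \<open>E\<close> are dropped and the others, all in the
      cone above \<open>c\<close>, are divided by x^c; the subtraction of exponents is exact
      there.\<close>
    define S where "S = Poly_Mapping.keys u - E"
    define f where "f = (\<Sum>e\<in>S. Poly_Mapping.single (\<lambda>j. e j - c j) (Poly_Mapping.lookup u e))"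
    have S: "c \<le> e" if "e \<in> S" for e
      using u that EF(2) by (auto simp: S_def monomial_span_def stanley_set_def)
    then have cS: "c + (\<lambda>j. e j - c j) = e" if "e \<in> S" for e
      using that by (auto simp: fun_eq_iff le_fun_def)
    have "u = (\<Sum>e\<in>Poly_Mapping.keys u. Poly_Mapping.single e (Poly_Mapping.lookup u e))"
      by (rule poly_mapping_sum_single)
    also have "\<dots> = (\<Sum>e\<in>Poly_Mapping.keys u \<inter> E. Poly_Mapping.single e (Poly_Mapping.lookup u e)) +
        (\<Sum>e\<in>S. Poly_Mapping.single e (Poly_Mapping.lookup u e))"
      unfolding S_def by (rule sum.Int_Diff) simp
    also have "(\<Sum>e\<in>S. Poly_Mapping.single e (Poly_Mapping.lookup u e)) = xpow c * f"
      unfolding f_def sum_distrib_left by (intro sum.cong) (auto simp: xpow_def mult_single cS)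
    finally have "u - xpow c * f = (\<Sum>e\<in>Poly_Mapping.keys u \<inter> E. Poly_Mapping.single e (Poly_Mapping.lookup u e))"
      by (rule diff_eq_eq[THEN iffD2])
    moreover have "\<dots> \<in> monomial_span E"
      by (rule is_ideal_sum[OF M.ideal_K]) (auto simp: monomial_span_def)
    moreover have "f \<in> deg_part (- (\<lambda>j. int (c j)) + d)" if "u \<in> deg_part d" for d
    proof -
      have keys: "Poly_Mapping.keys f \<subseteq> (\<Union>e\<in>S. {\<lambda>j. e j - c j})"
        unfolding f_def by (rule order_trans[OF keys_sum]) (auto split: if_splits)
      have deg: "int (e j - c j) = d j - int (c j)" if "e \<in> S" for e j
      proof -
        have "c j \<le> e j" using S[OF that] by (simp add: le_fun_def)
        moreover have "int (e j) = d j" using that \<open>u \<in> deg_part d\<close> by (auto simp: deg_part_def S_def)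
        ultimately show ?thesis by (simp add: of_nat_diff)
      qed
      show ?thesis
        unfolding deg_part_def
      proof (intro CollectI ballI allI)
        fix e j assume "e \<in> Poly_Mapping.keys f"
        then obtain e' where "e' \<in> S" "e = (\<lambda>j. e' j - c j)" using keys by blast
        then show "int (e j) = (- (\<lambda>j. int (c j)) + d) j" using deg[of e' j] by simp
      qed
    qed
    ultimately show ?thesis by (intro exI[of _ f]) simp
  qed
  \<comment> \<open>Division by x^c. The choice of \<open>f\<close> is harmless, since two
    candidates differ by an element of \<open>Z_prime Z\<close>.\<close>
  define \<phi> where "\<phi> x = \<beta> (SOME f. \<alpha> (xpow c * f) = x)" for x
  have \<phi>: "\<phi> (\<alpha> u) = \<beta> f" if "u \<in> monomial_span F" "u - xpow c * f \<in> monomial_span E" for u f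
  proof -
    define f' where "f' = (SOME f. \<alpha> (xpow c * f) = \<alpha> u)"
    have u: "\<alpha> u = \<alpha> (xpow c * f)" using M.eq_iff[OF that(1) mult_F] that(2) by blast
    then have "\<alpha> (xpow c * f') = \<alpha> u"
      unfolding f'_def by (intro someI[of "\<lambda>f. \<alpha> (xpow c * f) = \<alpha> u" f]) (rule sym)
    then have "xpow c * f' - xpow c * f \<in> monomial_span E"
      unfolding u using M.eq_iff[OF mult_F mult_F] by blast
    then have "f' - f \<in> Z_prime Z" unfolding right_diff_distrib[symmetric] mult_E .
    then show ?thesis using Q.eq_iff[of f' f] by (simp add: \<phi>_def f'_def)
  qed
  have repr: "\<exists>u f. u \<in> monomial_span F \<and> x = \<alpha> u \<and> u - xpow c * f \<in> monomial_span E \<and> \<phi> x = \<beta> f"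
    if x: "x \<in> carrier M" for x
  proof -
    obtain u where u: "u \<in> monomial_span F" "x = \<alpha> u" using x by (auto simp: M.carrier_eq)
    from quotient[OF u(1)] obtain f where f: "u - xpow c * f \<in> monomial_span E" by (elim exE conjE)
    show ?thesis
      by (intro exI[of _ u] exI[of _ f] conjI u f) (simp only: u(2) \<phi>[OF u(1) f])
  qed
  have \<phi>_xpow: "\<phi> (\<alpha> (xpow c * f)) = \<beta> f" for f
    by (rule \<phi>[OF mult_F]) (simp add: K'(1))
  have bij: "bij_betw \<phi> (carrier M) (carrier Q)"
    unfolding bij_betw_def
  proof
    show "inj_on \<phi> (carrier M)"
    proof (rule inj_onI)
      fix x y assume x: "x \<in> carrier M" and y: "y \<in> carrier M" and eq: "\<phi> x = \<phi> y"
      from repr[OF x] obtain u f where u: "u \<in> monomial_span F" "x = \<alpha> u"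
        "u - xpow c * f \<in> monomial_span E" "\<phi> x = \<beta> f" by (elim exE conjE)
      from repr[OF y] obtain v h where v: "v \<in> monomial_span F" "y = \<alpha> v"
        "v - xpow c * h \<in> monomial_span E" "\<phi> y = \<beta> h" by (elim exE conjE)
      have "f - h \<in> Z_prime Z" using Q.eq_iff[of f h] eq u(4) v(4) by simp
      then have "xpow c * (f - h) \<in> monomial_span E" by (simp only: mult_E)
      from K'(2)[OF K'(6)[OF u(3) v(3)] this] have "u - v \<in> monomial_span E"
        by (simp add: algebra_simps)
      then show "x = y" using M.eq_iff[OF u(1) v(1)] u(2) v(2) by simp
    qed
    show "\<phi> ` carrier M = carrier Q"
    proof
      show "\<phi> ` carrier M \<subseteq> carrier Q" by (auto simp: \<phi>_def Q.carrier_eq)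
      show "carrier Q \<subseteq> \<phi> ` carrier M"
        unfolding Q.carrier_eq M.carrier_eq
        by (intro image_subsetI, rule image_eqI, rule \<phi>_xpow[symmetric]) (intro imageI mult_F)
    qed
  qed
  have add: "\<phi> (x \<oplus>\<^bsub>M\<^esub> y) = \<phi> x \<oplus>\<^bsub>Q\<^esub> \<phi> y" if x: "x \<in> carrier M" and y: "y \<in> carrier M" for x y
  proof -
    from repr[OF x] obtain u f where u: "u \<in> monomial_span F" "x = \<alpha> u"
      "u - xpow c * f \<in> monomial_span E" "\<phi> x = \<beta> f" by (elim exE conjE)
    from repr[OF y] obtain v h where v: "v \<in> monomial_span F" "y = \<alpha> v"
      "v - xpow c * h \<in> monomial_span E" "\<phi> y = \<beta> h" by (elim exE conjE)
    have "u + v - xpow c * (f + h) \<in> monomial_span E"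
      using K'(2)[OF u(3) v(3)] by (simp add: algebra_simps)
    from \<phi>[OF L'(2)[OF u(1) v(1)] this] show ?thesis
      unfolding u(4) v(4) unfolding u(2) v(2) by (simp add: M.add_eq[OF u(1) v(1)] Q.add_eq)
  qed
  have smult: "\<phi> (s \<odot>\<^bsub>M\<^esub> x) = s \<odot>\<^bsub>Q\<^esub> \<phi> x" if x: "x \<in> carrier M" for s x
  proof -
    from repr[OF x] obtain u f where u: "u \<in> monomial_span F" "x = \<alpha> u"
      "u - xpow c * f \<in> monomial_span E" "\<phi> x = \<beta> f" by (elim exE conjE)
    have "s * u - xpow c * (s * f) \<in> monomial_span E"
      using K'(3)[OF u(3), of s] by (simp add: algebra_simps)
    from \<phi>[OF L'(3)[OF u(1)] this] show ?thesis
      unfolding u(4) unfolding u(2) by (simp add: M.smult_eq[OF u(1)] Q.smult_eq)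
  qed
  have "\<phi> ` hcomp M d = hcomp Q (- (\<lambda>j. int (c j)) + d)" for d
  proof
    show "\<phi> ` hcomp M d \<subseteq> hcomp Q (- (\<lambda>j. int (c j)) + d)"
      unfolding M.hcomp_eq Q.hcomp_eq image_image
    proof (intro image_subsetI)
      fix u :: "('n, 'k) mpoly" assume u: "u \<in> monomial_span F \<inter> deg_part d"
      then obtain f where f: "u - xpow c * f \<in> monomial_span E"
        "\<forall>d. u \<in> deg_part d \<longrightarrow> f \<in> deg_part (- (\<lambda>j. int (c j)) + d)"
        using quotient[OF IntD1[OF u]] by (elim exE conjE)
      have "\<phi> (\<alpha> u) = \<beta> f" using u f(1) by (intro \<phi>) simp_all
      then show "\<phi> (\<alpha> u) \<in> \<beta> ` (UNIV \<inter> deg_part (- (\<lambda>j. int (c j)) + d))" using u f(2) by simp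
    qed
    show "hcomp Q (- (\<lambda>j. int (c j)) + d) \<subseteq> \<phi> ` hcomp M d"
      unfolding M.hcomp_eq Q.hcomp_eq
    proof (intro image_subsetI)
      fix f :: "('n, 'k) mpoly" assume "f \<in> UNIV \<inter> deg_part (- (\<lambda>j. int (c j)) + d)"
      then have "xpow c * f \<in> deg_part d" by (auto simp: deg_part_def keys_xpow_mult)
      then have "\<alpha> (xpow c * f) \<in> \<alpha> ` (monomial_span F \<inter> deg_part d)" using mult_F by blast
      then show "\<beta> f \<in> \<phi> ` \<alpha> ` (monomial_span F \<inter> deg_part d)"
        by (intro image_eqI[of _ \<phi> "\<alpha> (xpow c * f)"]) (simp only: \<phi>_xpow)
    qed
  qed
  then show ?thesis
    unfolding gr_iso_def using bij add smult by (intro exI[of _ \<phi>]) auto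
qed

text \<open>A preimage of the class of 1 has degree \<open>a\<close>, hence is represented by a
  nonzero multiple of one monomial x^c, and its class has annihilator \<open>Z_prime Z\<close>. This
  yields the cone at \<open>c\<close>. Any other monomial surviving in the quotient has a nonzero
  image, whose degree places the monomial in the same cone.\<close>

lemma gr_iso_imp_stanley_set:
  fixes M :: "(('n::finite, 'k::field) mpoly, 'm, 'n) gr_module"
    and Q :: "(('n, 'k) mpoly, 'l, 'n) gr_module"
  assumes M: "presentation M (monomial_span F) (monomial_span E) \<alpha>"
    and Q: "presentation Q UNIV (Z_prime Z) \<beta>"
    and F: "up_closed F" and iso: "gr_iso M (gr_shift Q (- a))"
  shows "\<exists>c. F - E = stanley_set c Z"
proof -
  interpret M: presentation M "monomial_span F" "monomial_span E" \<alpha> by (rule M)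
  interpret Q: presentation Q UNIV "Z_prime Z" \<beta> by (rule Q)
  note L' = is_idealD[OF M.ideal_L] and K' = is_idealD[OF M.ideal_K]
  obtain \<phi> where bij: "bij_betw \<phi> (carrier M) (carrier Q)"
    and smult: "\<And>s u. u \<in> carrier M \<Longrightarrow> \<phi> (s \<odot>\<^bsub>M\<^esub> u) = s \<odot>\<^bsub>Q\<^esub> \<phi> u"
    and hcomp: "\<And>d. \<phi> ` hcomp M d = hcomp Q (- a + d)"
    using iso unfolding gr_iso_def by auto
  \<comment> \<open>In the module shifted by \<open>- a\<close> the class of 1 has degree
    \<open>a\<close>.\<close>
  have "1 \<in> deg_part (- a + a)" by (simp add: deg_part_def)
  then have "\<beta> 1 \<in> \<phi> ` hcomp M a" unfolding hcomp Q.hcomp_eq by blast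
  then obtain u where u: "u \<in> monomial_span F" "u \<in> deg_part a" "\<phi> (\<alpha> u) = \<beta> 1"
    by (auto simp: M.hcomp_eq)
  have \<phi>_mult: "\<phi> (\<alpha> (f * u)) = \<beta> f" for f
    using smult[of "\<alpha> u" f] u by (simp add: M.carrier_eq M.smult_eq Q.smult_eq)
  have mult_E: "f * u \<in> monomial_span E \<longleftrightarrow> f \<in> Z_prime Z" for f
  proof -
    have "f * u \<in> monomial_span E \<longleftrightarrow> \<alpha> (f * u) = \<alpha> (0 * u)"
      using M.eq_iff[of "f * u" "0 * u"] L'(1,3) u(1) by simp
    also have "\<dots> \<longleftrightarrow> \<phi> (\<alpha> (f * u)) = \<phi> (\<alpha> (0 * u))"
    proof -
      have "\<alpha> (f * u) \<in> carrier M" "\<alpha> (0 * u) \<in> carrier M"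
        using L'(3)[OF u(1)] unfolding M.carrier_eq by blast+
      then show ?thesis using bij by (metis bij_betw_def inj_on_eq_iff)
    qed
    also have "\<dots> \<longleftrightarrow> f \<in> Z_prime Z" unfolding \<phi>_mult using Q.eq_iff[of f 0] by simp
    finally show ?thesis .
  qed
  have "1 \<notin> (Z_prime Z :: ('n, 'k) mpoly set)" using is_prime_Z_prime by (auto simp: is_prime_def)
  then have "u \<notin> monomial_span E" using mult_E[of 1] by simp
  then obtain c where c: "c \<in> Poly_Mapping.keys u" "c \<notin> E" by (auto simp: monomial_span_def)
  have a: "a j = int (c j)" for j using c u(2) by (auto simp: deg_part_def)
  obtain k where k: "u = Poly_Mapping.single c k" "k \<noteq> 0"
    using deg_part_single[OF u(2) c(1)] c(1) by (metis in_keys_iff)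
  have "c \<in> F" using c(1) u(1) by (auto simp: monomial_span_def)
  have "F - E = stanley_set c Z"
  proof
    show "stanley_set c Z \<subseteq> F - E"
    proof
      fix e assume "e \<in> stanley_set c Z"
      then obtain z where z: "z \<in> Z_exponents Z" "e = c + z" by (auto simp: stanley_set_eq)
      then have "xpow z * u \<notin> monomial_span E" by (simp add: mult_E Z_prime_def)
      moreover have "xpow z * u = Poly_Mapping.single e k"
        using z by (simp add: k xpow_def mult_single add.commute)
      ultimately have "e \<notin> E" using k by (simp add: monomial_span_def)
      moreover have "e \<in> F" using F \<open>c \<in> F\<close> z by (auto simp: up_closed_def le_fun_def)
      ultimately show "e \<in> F - E" by simp
    qed
    show "F - E \<subseteq> stanley_set c Z"
    proof
      fix e assume e: "e \<in> F - E"
      have "xpow e \<in> deg_part (\<lambda>j. int (e j))" by (simp add: deg_part_def xpow_def)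
      then have "\<alpha> (xpow e) \<in> hcomp M (\<lambda>j. int (e j))" using e unfolding M.hcomp_eq by auto
      then have "\<phi> (\<alpha> (xpow e)) \<in> hcomp Q (- a + (\<lambda>j. int (e j)))" using hcomp by blast
      then obtain f where f: "f \<in> deg_part (- a + (\<lambda>j. int (e j)))" "\<phi> (\<alpha> (xpow e)) = \<beta> f"
        by (auto simp: Q.hcomp_eq)
      have "f \<notin> Z_prime Z"
      proof
        assume "f \<in> Z_prime Z"
        then have "\<beta> f = \<beta> 0" using Q.eq_iff[of f 0] by simp
        then have "\<phi> (\<alpha> (xpow e)) = \<phi> (\<alpha> 0)" using f(2) \<phi>_mult[of 0] by simp
        then have "\<alpha> (xpow e) = \<alpha> 0"
          using bij e L'(1) by (auto simp: bij_betw_def M.carrier_eq inj_on_eq_iff)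
        then have "xpow e \<in> monomial_span E" using M.eq_iff[of "xpow e" 0] e L'(1) by simp
        then show False using e by simp
      qed
      \<comment> \<open>A polynomial outside \<open>Z_prime Z\<close> has a term in K[Z]; comparison
        of degrees shows that its exponent is \<open>e - c\<close>.\<close>
      then obtain z where z: "z \<in> Poly_Mapping.keys f" "z \<in> Z_exponents Z" by (auto simp: Z_prime_alt)
      have "int (z j) = int (e j) - int (c j)" for j
        using z(1) f(1) a[of j] by (auto simp: deg_part_def)
      then have "e j = c j + z j" for j by (metis add_diff_cancel_left' diff_add_cancel add.commute of_nat_add of_nat_eq_iff)
      then have "e = c + z" by (auto simp: fun_eq_iff)
      then show "e \<in> stanley_set c Z" using z(2) by (simp add: add_in_stanley_set_iff)
    qed
  qed
  then show ?thesis by (rule exI[of _ c])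
qed

subsection \<open>Ordered partitions of the characteristic poset\<close>

text \<open>The combinatorial shadow of a prime filtration, each cone being listed as apex and
  directions. Growth at the end of the list matches a filtration growing upwards.\<close>

inductive stanley_chain ::
    "('n \<Rightarrow> nat) set \<Rightarrow> (('n \<Rightarrow> nat) \<times> 'n set) list \<Rightarrow> ('n \<Rightarrow> nat) set \<Rightarrow> bool"
  for E0 where
  Nil: "stanley_chain E0 [] E0"
| snoc: "stanley_chain E0 cs E \<Longrightarrow> stanley_set c Z \<inter> E = {} \<Longrightarrow> up_closed (E \<union> stanley_set c Z) \<Longrightarrow>
    stanley_chain E0 (cs @ [(c, Z)]) (E \<union> stanley_set c Z)"

lemma stanley_chain_subset: "stanley_chain E0 cs E \<Longrightarrow> E0 \<subseteq> E"
  by (induction rule: stanley_chain.induct) auto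

text \<open>The condition of the theorem with the covered set \<open>D\<close> as an extra argument.
  A prefix of an ordered partition of \<open>P\<close> covers only a poset ideal, so inductions on
  the list need \<open>D\<close> to vary.\<close>

definition ordered_partition :: "'p::order set \<Rightarrow> ('p \<times> 'p) list \<Rightarrow> 'p set \<Rightarrow> bool"
  where "ordered_partition P cds D \<longleftrightarrow>
    (\<forall>(c, d)\<in>set cds. c \<in> P \<and> d \<in> P \<and> c \<le> d) \<and>
    (\<forall>i<length cds. \<forall>j<length cds. i \<noteq> j \<longrightarrow>
      poset_interval P (fst (cds ! i)) (snd (cds ! i)) \<inter>
      poset_interval P (fst (cds ! j)) (snd (cds ! j)) = {}) \<and>
    (\<Union>(c, d)\<in>set cds. poset_interval P c d) = D \<and>
    (\<forall>j\<le>length cds. poset_ideal P (\<Union>(c, d)\<in>set (take j cds). poset_interval P c d))"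

lemma ordered_partition_iff:
  "ordered_partition P cds P \<longleftrightarrow> interval_partition P cds \<and>
    (\<forall>j\<le>length cds. poset_ideal P (\<Union>(c, d)\<in>set (take j cds). poset_interval P c d))"
  unfolding ordered_partition_def interval_partition_def by (simp only: conj_assoc)

lemma ordered_partition_Nil: "ordered_partition P [] {}"
  by (simp add: ordered_partition_def poset_ideal_def)

text \<open>Splits off the last interval, in parallel to the rule \<open>snoc\<close> of
  \<open>stanley_chain\<close>; both translations between chains and partitions run along
  it.\<close>

lemma ordered_partition_snoc_iff:
  "ordered_partition P (cds @ [(c, d)]) D' \<longleftrightarrow>
    (\<exists>D. ordered_partition P cds D \<and> D' = D \<union> poset_interval P c d \<and> D \<inter> poset_interval P c d = {} \<and>
      c \<in> P \<and> d \<in> P \<and> c \<le> d \<and> poset_ideal P D')"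
proof -
  let ?I = "\<lambda>x. poset_interval P (fst x) (snd x)"
  let ?n = "length cds"
  define U where "U = (\<Union>(c, d)\<in>set cds. poset_interval P c d)"
  have U: "U = (\<Union>x\<in>set cds. ?I x)" by (simp add: U_def case_prod_unfold)
  have all: "(\<forall>(c, d)\<in>set (cds @ [(c, d)]). c \<in> P \<and> d \<in> P \<and> c \<le> d) \<longleftrightarrow>
      (\<forall>(c, d)\<in>set cds. c \<in> P \<and> d \<in> P \<and> c \<le> d) \<and> c \<in> P \<and> d \<in> P \<and> c \<le> d"
    by auto
  have union: "(\<Union>(c, d)\<in>set (cds @ [(c, d)]). poset_interval P c d) = U \<union> poset_interval P c d"
    by (simp add: U_def Un_commute)
  have disj: "(\<forall>i<length (cds @ [(c, d)]). \<forall>j<length (cds @ [(c, d)]). i \<noteq> j \<longrightarrow>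
        ?I ((cds @ [(c, d)]) ! i) \<inter> ?I ((cds @ [(c, d)]) ! j) = {}) \<longleftrightarrow>
      (\<forall>i<?n. \<forall>j<?n. i \<noteq> j \<longrightarrow> ?I (cds ! i) \<inter> ?I (cds ! j) = {}) \<and>
      U \<inter> poset_interval P c d = {}" (is "?l \<longleftrightarrow> ?r1 \<and> ?r2")
  proof
    assume l: ?l
    have ?r1
    proof (intro allI impI)
      fix i j assume "i < ?n" "j < ?n" "i \<noteq> j"
      then show "?I (cds ! i) \<inter> ?I (cds ! j) = {}"
        using l[rule_format, of i j] by (simp add: nth_append)
    qed
    moreover have ?r2
    proof -
      have "?I (cds ! i) \<inter> poset_interval P c d = {}" if "i < ?n" for i
        using l[rule_format, of i ?n] that by (simp add: nth_append)
      then have "?I x \<inter> poset_interval P c d = {}" if "x \<in> set cds" for x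
        using that by (metis in_set_conv_nth)
      then show ?thesis unfolding U by blast
    qed
    ultimately show "?r1 \<and> ?r2" ..
  next
    assume r: "?r1 \<and> ?r2"
    have last: "?I (cds ! i) \<inter> poset_interval P c d = {}" if "i < ?n" for i
      using conjunct2[OF r] nth_mem[OF that] unfolding U by blast
    show ?l
    proof (intro allI impI)
      fix i j assume "i < length (cds @ [(c, d)])" "j < length (cds @ [(c, d)])" "i \<noteq> j"
      then consider "i < ?n" "j < ?n" | "i < ?n" "j = ?n" | "i = ?n" "j < ?n" by fastforce
      then show "?I ((cds @ [(c, d)]) ! i) \<inter> ?I ((cds @ [(c, d)]) ! j) = {}"
      proof cases
        case 1
        then show ?thesis using conjunct1[OF r] \<open>i \<noteq> j\<close> by (simp add: nth_append)
      next
        case 2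
        then show ?thesis using last[of i] by (simp add: nth_append)
      next
        case 3
        then show ?thesis using last[of j] by (simp add: nth_append Int_commute)
      qed
    qed
  qed
  have take: "(\<forall>j\<le>length (cds @ [(c, d)]). Q (take j (cds @ [(c, d)]))) \<longleftrightarrow>
      (\<forall>j\<le>?n. Q (take j cds)) \<and> Q (cds @ [(c, d)])" for Q :: "('a \<times> 'a) list \<Rightarrow> bool"
  proof -
    have "(\<forall>j\<le>Suc ?n. S j) \<longleftrightarrow> (\<forall>j\<le>?n. S j) \<and> S (Suc ?n)" for S :: "nat \<Rightarrow> bool"
      by (metis le_Suc_eq)
    then show ?thesis by simp
  qed
  define a where "a \<longleftrightarrow> (\<forall>(c, d)\<in>set cds. c \<in> P \<and> d \<in> P \<and> c \<le> d)"
  define r where "r \<longleftrightarrow> (\<forall>i<?n. \<forall>j<?n. i \<noteq> j \<longrightarrow> ?I (cds ! i) \<inter> ?I (cds ! j) = {})"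
  define t where "t \<longleftrightarrow> (\<forall>j\<le>?n. poset_ideal P (\<Union>(c, d)\<in>set (take j cds). poset_interval P c d))"
  have init: "ordered_partition P cds D \<longleftrightarrow> a \<and> r \<and> U = D \<and> t" for D
    unfolding ordered_partition_def a_def r_def U_def t_def by (rule refl)
  have snoc: "ordered_partition P (cds @ [(c, d)]) D' \<longleftrightarrow>
      (a \<and> c \<in> P \<and> d \<in> P \<and> c \<le> d) \<and> (r \<and> U \<inter> poset_interval P c d = {}) \<and>
      U \<union> poset_interval P c d = D' \<and> t \<and> poset_ideal P (U \<union> poset_interval P c d)"
    unfolding ordered_partition_def disj all union a_def[symmetric] r_def[symmetric]
      take[of "\<lambda>xs. poset_ideal P (\<Union>(c, d)\<in>set xs. poset_interval P c d)"] t_def[symmetric]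
    by (rule refl)
  show ?thesis
    unfolding init snoc
  proof (intro iffI; (elim exE conjE)?)
    fix D
    assume "U = D" "D' = D \<union> poset_interval P c d" "poset_ideal P D'" "a" "r" "t"
      "D \<inter> poset_interval P c d = {}" "c \<in> P" "d \<in> P" "c \<le> d"
    then show "(a \<and> c \<in> P \<and> d \<in> P \<and> c \<le> d) \<and> (r \<and> U \<inter> poset_interval P c d = {}) \<and>
      U \<union> poset_interval P c d = D' \<and> t \<and> poset_ideal P (U \<union> poset_interval P c d)" by simp
  qed (intro exI[of _ U], simp)
qed

text \<open>Singleton intervals do: removing a minimal element of an upward closed set leaves it
  upward closed, and that element is placed last. The maximum of the theorem is thus taken over a
  nonempty set.\<close>

lemma ordered_partition_exists:
  assumes "finite P" and "poset_ideal P D"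
  shows "\<exists>cds. ordered_partition P cds D"
  using assms(2)
proof (induction "card D" arbitrary: D)
  case 0
  then have "D = {}" using assms(1) by (auto simp: poset_ideal_def dest: finite_subset)
  then show ?case using ordered_partition_Nil by blast
next
  case (Suc n)
  then have fin: "finite D" "D \<subseteq> P" "D \<noteq> {}" by (auto simp: poset_ideal_def intro: card_ge_0_finite)
  obtain a where a: "a \<in> D" "\<And>b. b \<in> D \<Longrightarrow> b \<le> a \<Longrightarrow> a = b"
    using finite_has_minimal[OF fin(1,3)] by blast
  have ideal: "poset_ideal P (D - {a})"
    using Suc.prems a unfolding poset_ideal_def by blast
  moreover have "card (D - {a}) = n" using Suc.hyps(2) fin a(1) by simp
  ultimately obtain cds where "ordered_partition P cds (D - {a})" using Suc.hyps(1) by blast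
  moreover have "poset_interval P a a = {a}" using a(1) fin(2) by (auto simp: poset_interval_def)
  moreover have "D = D - {a} \<union> {a}" using a(1) by blast
  ultimately have "ordered_partition P (cds @ [(a, a)]) D"
    unfolding ordered_partition_snoc_iff using a(1) fin(2) Suc.prems by (intro exI[of _ "D - {a}"]) auto
  then show ?case by (rule exI)
qed

section \<open>Truncation to the box below g\<close>

definition trunc :: "('n \<Rightarrow> nat) \<Rightarrow> ('n \<Rightarrow> nat) \<Rightarrow> 'n \<Rightarrow> nat"
  where "trunc g e = (\<lambda>j. min (e j) (g j))"

lemma trunc_le [simp]: "trunc g e \<le> g"
  by (simp add: trunc_def le_fun_def)

lemma le_trunc_iff: "c \<le> trunc g e \<longleftrightarrow> c \<le> e \<and> c \<le> g"
  by (auto simp: trunc_def le_fun_def)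

lemma trunc_mono: "e \<le> f \<Longrightarrow> trunc g e \<le> trunc g f"
  by (simp add: trunc_def le_fun_def min.coboundedI1)

context
  fixes A B :: "('n::finite \<Rightarrow> nat) set" and g :: "'n \<Rightarrow> nat"
  assumes A_le: "\<forall>a\<in>A. a \<le> g" and B_le: "\<forall>b\<in>B. b \<le> g"
begin

text \<open>For \<open>c \<le> g\<close>, the relation \<open>c \<le> e\<close> holds exactly if it
  holds for the truncation of \<open>e\<close>. All generators are of this kind.\<close>

lemma trunc_in_char_poset_iff: "trunc g e \<in> char_poset A B g \<longleftrightarrow> e \<in> upset A - upset B"
  using A_le B_le by (auto simp: char_poset_def upset_def le_trunc_iff)

lemma char_poset_eq: "char_poset A B g = {c \<in> upset A - upset B. c \<le> g}"
  by (auto simp: char_poset_def upset_def)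

lemma finite_char_poset: "finite (char_poset A B g)"
proof (rule finite_subset)
  show "char_poset A B g \<subseteq> (\<Pi>\<^sub>E j\<in>UNIV. {..g j})"
    by (auto simp: char_poset_def le_fun_def)
qed (intro finite_PiE; simp)

text \<open>The poset is convex: the condition from \<open>A\<close> passes upwards from
  \<open>c\<close>, those from \<open>B\<close> and \<open>g\<close> pass downwards from
  \<open>d\<close>.\<close>

lemma poset_interval_char_poset:
  assumes "c \<in> char_poset A B g" and "d \<in> char_poset A B g"
  shows "poset_interval (char_poset A B g) c d = {e. c \<le> e \<and> e \<le> d}"
proof -
  have "e \<in> char_poset A B g" if e: "c \<le> e" "e \<le> d" for e
  proof -
    obtain a where "a \<in> A" "a \<le> c" using assms(1) by (auto simp: char_poset_def)
    moreover have "a \<le> e" using \<open>a \<le> c\<close> e(1) by (rule order_trans)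
    moreover have "\<not> b \<le> e" if "b \<in> B" for b
      using assms(2) that order_trans[OF _ e(2)] by (auto simp: char_poset_def)
    moreover have "e \<le> g" using order_trans[OF e(2)] assms(2) by (simp add: char_poset_def)
    ultimately show ?thesis by (auto simp: char_poset_def)
  qed
  then show ?thesis by (auto simp: poset_interval_def)
qed

text \<open>A cone meets the box below \<open>g\<close> only if its apex is in the box, and then in
  an interval starting at the apex. The last conjunct is stated per interval and as an inclusion,
  which suffices to bound the dimensions of the intervals from below.\<close>

lemma stanley_chain_imp_ordered_partition:
  assumes "stanley_chain (upset B) cs E" and "E \<subseteq> upset A"
  shows "\<exists>cds. ordered_partition (char_poset A B g) cds (char_poset A B g \<inter> E) \<and>
    (\<forall>(c, d)\<in>set cds. \<exists>(c', Z)\<in>set cs. Z \<subseteq> Zvars g d)"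
  using assms
proof (induction rule: stanley_chain.induct)
  case Nil
  have "char_poset A B g \<inter> upset B = {}" by (auto simp: char_poset_def upset_def)
  then show ?case using ordered_partition_Nil by (intro exI[of _ "[]"]) simp
next
  case (snoc cs E c Z)
  let ?P = "char_poset A B g" and ?U = "stanley_set c Z"
  obtain cds where cds: "ordered_partition ?P cds (?P \<inter> E)"
    "\<forall>(c, d)\<in>set cds. \<exists>(c', Z)\<in>set cs. Z \<subseteq> Zvars g d"
    using snoc by auto
  have U: "?U \<subseteq> upset A - upset B"
    using snoc.hyps(2) snoc.prems stanley_chain_subset[OF snoc.hyps(1)] by blast
  show ?case
  proof (cases "c \<le> g")
    \<comment> \<open>The whole cone lies outside the box, so it adds no interval.\<close>
    case False
    then have "?P \<inter> ?U = {}" by (auto simp: char_poset_def stanley_set_def dest: order_trans)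
    then have "?P \<inter> (E \<union> ?U) = ?P \<inter> E" by blast
    then show ?thesis using cds by (intro exI[of _ cds]) fastforce
  next
    case True
    \<comment> \<open>The largest element of the cone below \<open>g\<close>: the free directions
      are raised to \<open>g\<close>. A direction outside \<open>Z\<close> with
      \<open>c j = g j\<close> also counts for \<open>Zvars g d\<close>, whence only an
      inclusion.\<close>
    define d where "d = (\<lambda>j. if j \<in> Z then g j else c j)"
    have "c \<le> d" "d \<le> g" using True by (auto simp: d_def le_fun_def)
    then have in_U: "c \<in> ?U" "d \<in> ?U" by (auto simp: stanley_set_def d_def)
    then have cd: "c \<in> ?P" "d \<in> ?P" using U True \<open>d \<le> g\<close> by (auto simp: char_poset_eq)
    have interval: "poset_interval ?P c d = ?P \<inter> ?U"
    proof -
      have "e \<le> d \<longleftrightarrow> (\<forall>j. j \<notin> Z \<longrightarrow> e j = c j)" if "c \<le> e" "e \<le> g" for e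
        using that unfolding le_fun_def d_def by (metis order_antisym)
      then show ?thesis
        by (auto simp: poset_interval_def stanley_set_def char_poset_def)
    qed
    have "poset_ideal ?P (?P \<inter> (E \<union> ?U))"
      using snoc.hyps(3) by (auto simp: poset_ideal_def up_closed_def)
    then have "ordered_partition ?P (cds @ [(c, d)]) (?P \<inter> (E \<union> ?U))"
      unfolding ordered_partition_snoc_iff interval
      using cds(1) snoc.hyps(2) cd \<open>c \<le> d\<close> by (intro exI[of _ "?P \<inter> E"]) auto
    moreover have "Z \<subseteq> Zvars g d" by (auto simp: Zvars_def d_def)
    ultimately show ?thesis using cds(2) by (intro exI[of _ "cds @ [(c, d)]"]) fastforce
  qed
qed

text \<open>The set \<open>upset B \<union> {e. trunc g e \<in> D}\<close> is upward closed because
  \<open>D\<close> is a poset ideal. Attaching one interval takes an inner induction over its cones,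
  during which upward closedness has to be shown for every partial union.\<close>

lemma ordered_partition_imp_stanley_chain:
  assumes "ordered_partition (char_poset A B g) cds D"
  shows "\<exists>cs. stanley_chain (upset B) cs (upset B \<union> {e. trunc g e \<in> D}) \<and>
    (\<forall>(c', Z)\<in>set cs. \<exists>(c, d)\<in>set cds. Z = Zvars g d)"
  using assms
proof (induction cds arbitrary: D rule: rev_induct)
  case Nil
  then have "D = {}" by (simp add: ordered_partition_def)
  then show ?case using stanley_chain.Nil by (intro exI[of _ "[]"]) simp
next
  case (snoc cd cds)
  let ?P = "char_poset A B g"
  obtain c d where cd_eq: "cd = (c, d)" by fastforce
  define Z where "Z = Zvars g d"
  obtain D0 where D0: "ordered_partition ?P cds D0" "D = D0 \<union> poset_interval ?P c d"
      "D0 \<inter> poset_interval ?P c d = {}" and cd: "c \<in> ?P" "d \<in> ?P" "c \<le> d" and ideal: "poset_ideal ?P D"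
    using snoc.prems unfolding cd_eq ordered_partition_snoc_iff by blast
  define E where "E = upset B \<union> {e. trunc g e \<in> D0}"
  obtain cs where cs: "stanley_chain (upset B) cs E" "\<forall>(c', Z)\<in>set cs. \<exists>(c, d)\<in>set cds. Z = Zvars g d"
    using snoc.IH[OF D0(1)] unfolding E_def by blast
  have le_g: "c \<le> g" "d \<le> g" using cd by (auto simp: char_poset_def)
  note interval = poset_interval_char_poset[OF cd(1,2)]
  \<comment> \<open>The apexes of the summands that the interval contributes to the Stanley
    decomposition. In a direction of \<open>Z\<close> the end \<open>d\<close> reaches
    \<open>g\<close>, so exponents are free upwards from \<open>c\<close>; in any other direction
    \<open>d\<close> is below \<open>g\<close>, so truncation changes nothing and the entry of the
    exponent becomes that of the apex.\<close>
  define C where "C = {c'. c \<le> c' \<and> c' \<le> d \<and> (\<forall>j\<in>Z. c' j = c j)}"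
  have "finite C"
  proof (rule finite_subset)
    show "C \<subseteq> ?P" using interval by (auto simp: C_def poset_interval_def)
  qed (rule finite_char_poset)
  have in_C: "\<exists>c'\<in>C. e \<in> stanley_set c' Z \<and> (\<forall>j. j \<notin> Z \<longrightarrow> c' j = e j)" if e: "trunc g e \<in> poset_interval ?P c d" for e
  proof -
    have e': "c j \<le> e j" "min (e j) (g j) \<le> d j" for j
      using e unfolding interval by (auto simp: le_fun_def trunc_def)
    have "e j \<le> d j" if "j \<notin> Z" for j
    proof -
      have "d j < g j" using that le_g(2) by (auto simp: Z_def Zvars_def le_fun_def nat_less_le)
      then show ?thesis using e'(2)[of j] by auto
    qed
    then show ?thesis
      using e'(1) cd(3) by (intro bexI[of _ "\<lambda>j. if j \<in> Z then c j else e j"])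
        (auto simp: C_def stanley_set_def le_fun_def)
  qed
  have from_C: "trunc g e \<in> poset_interval ?P c d" if "c' \<in> C" "e \<in> stanley_set c' Z" for c' e
  proof -
    have "min (e j) (g j) \<le> d j" for j
      using that by (cases "j \<in> Z") (auto simp: C_def stanley_set_def Z_def Zvars_def le_fun_def min.coboundedI1)
    moreover have "c \<le> e" using that by (auto simp: C_def stanley_set_def intro: order_trans)
    ultimately show ?thesis unfolding interval using le_g by (auto simp: le_fun_def trunc_def)
  qed
  have C_disj: "stanley_set c' Z \<inter> stanley_set c'' Z = {}" if "c' \<in> C" "c'' \<in> C" "c' \<noteq> c''" for c' c''
  proof -
    obtain j where "c' j \<noteq> c'' j" using \<open>c' \<noteq> c''\<close> by (auto simp: fun_eq_iff)
    moreover from this have "j \<notin> Z" using that by (auto simp: C_def)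
    ultimately show ?thesis by (auto simp: stanley_set_def)
  qed
  have E_disj: "stanley_set c' Z \<inter> E = {}" if "c' \<in> C" for c'
  proof -
    have "e \<notin> E" if "trunc g e \<in> poset_interval ?P c d" for e
      using that D0(3) trunc_in_char_poset_iff[of e] by (auto simp: E_def poset_interval_def)
    then show ?thesis using from_C[OF that] by blast
  qed
  \<comment> \<open>\<open>C'\<close> runs through the upward closed subsets of \<open>C\<close>. A
    minimal element \<open>a\<close> is attached last, which leaves \<open>C' - {a}\<close> upward
    closed for the induction hypothesis.\<close>
  have "\<exists>cs'. stanley_chain (upset B) cs' (E \<union> (\<Union>c'\<in>C'. stanley_set c' Z)) \<and> set cs' = set cs \<union> C' \<times> {Z}"
    if "C' \<subseteq> C" "\<And>a b. a \<in> C' \<Longrightarrow> b \<in> C \<Longrightarrow> a \<le> b \<Longrightarrow> b \<in> C'" for C'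
    using that
  proof (induction "card C'" arbitrary: C')
    case 0
    then have "C' = {}" using \<open>finite C\<close> by (auto dest: finite_subset)
    then show ?case using cs(1) by (intro exI[of _ cs]) simp
  next
    case (Suc n)
    then have fin: "finite C'" "C' \<noteq> {}" by (auto intro: card_ge_0_finite)
    obtain a where a: "a \<in> C'" "\<And>b. b \<in> C' \<Longrightarrow> b \<le> a \<Longrightarrow> a = b"
      using finite_has_minimal[OF fin] by blast
    have aC: "a \<in> C" using a(1) Suc.prems(1) by blast
    let ?E' = "E \<union> (\<Union>c'\<in>C' - {a}. stanley_set c' Z)"
    have "n = card (C' - {a})" using Suc.hyps(2) a(1) by simp
    moreover have "C' - {a} \<subseteq> C" using Suc.prems(1) by blast
    moreover have "y \<in> C' - {a}" if "x \<in> C' - {a}" "y \<in> C" "x \<le> y" for x y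
      using that Suc.prems(2)[of x y] a(2)[of x] by auto
    ultimately obtain cs' where cs': "stanley_chain (upset B) cs' ?E'" "set cs' = set cs \<union> (C' - {a}) \<times> {Z}"
      using Suc.hyps(1)[of "C' - {a}"] by blast
    have E_eq: "?E' \<union> stanley_set a Z = E \<union> (\<Union>c'\<in>C'. stanley_set c' Z)" using a(1) by blast
    have disj: "stanley_set a Z \<inter> ?E' = {}"
      using E_disj[OF aC] C_disj[OF aC] Suc.prems(1) by blast
    have "up_closed (?E' \<union> stanley_set a Z)"
      unfolding E_eq up_closed_def
    proof (intro ballI allI impI)
      fix e f assume e: "e \<in> E \<union> (\<Union>c'\<in>C'. stanley_set c' Z)" and "e \<le> f"
      show "f \<in> E \<union> (\<Union>c'\<in>C'. stanley_set c' Z)"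
      proof (cases "f \<in> upset B")
        case True
        then show ?thesis by (simp add: E_def)
      next
        case False
        then have "e \<notin> upset B" using up_closed_upset[of B] \<open>e \<le> f\<close> by (auto simp: up_closed_def)
        then have eD: "trunc g e \<in> D0 \<or> (\<exists>c'\<in>C'. e \<in> stanley_set c' Z)" using e by (auto simp: E_def)
        then have "trunc g e \<in> D" using D0(2) from_C Suc.prems(1) by blast
        moreover from this have "trunc g e \<in> ?P" using ideal by (auto simp: poset_ideal_def)
        then have "e \<in> upset A" by (simp add: trunc_in_char_poset_iff)
        then have "f \<in> upset A" using up_closed_upset[of A] \<open>e \<le> f\<close> by (auto simp: up_closed_def)
        then have fP: "trunc g f \<in> ?P" using False by (simp add: trunc_in_char_poset_iff)
        moreover have le: "trunc g e \<le> trunc g f" using \<open>e \<le> f\<close> by (rule trunc_mono)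
        ultimately have "trunc g f \<in> D" using ideal by (auto simp: poset_ideal_def)
        then consider "trunc g f \<in> D0" | "trunc g f \<in> poset_interval ?P c d" "trunc g f \<notin> D0" using D0(2) by blast
        then show ?thesis
        proof cases
          case 1
          then show ?thesis by (simp add: E_def)
        next
          case 2
          obtain b where b: "b \<in> C" "f \<in> stanley_set b Z" "\<forall>j. j \<notin> Z \<longrightarrow> b j = f j"
            using in_C[OF 2(1)] by blast
          \<comment> \<open>\<open>D0\<close> is upward closed in the poset, so \<open>e\<close>
            cannot come from an earlier interval. Both exponents then lie in cones of the present
            one, and their apexes compare as \<open>c' \<le> b\<close>.\<close>
          have "trunc g e \<notin> D0"
          proof
            assume "trunc g e \<in> D0"
            moreover have "poset_ideal ?P D0" using D0(1) by (auto simp: ordered_partition_def)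
            ultimately show False using 2(2) fP le by (auto simp: poset_ideal_def)
          qed
          then obtain c' where c': "c' \<in> C'" "e \<in> stanley_set c' Z" using eD by blast
          have "c' j \<le> b j" for j
          proof (cases "j \<in> Z")
            case True
            then show ?thesis using b(1) c'(1) Suc.prems(1) by (auto simp: C_def)
          next
            case False
            then have "c' j = e j" "b j = f j" using c'(2) b(3) by (auto simp: stanley_set_def)
            then show ?thesis using \<open>e \<le> f\<close> by (simp add: le_fun_def)
          qed
          then have "b \<in> C'" using Suc.prems(2)[OF c'(1) b(1)] by (simp add: le_fun_def)
          then show ?thesis using b(2) by blast
        qed
      qed
    qed
    from stanley_chain.snoc[OF cs'(1) disj this]
    have "stanley_chain (upset B) (cs' @ [(a, Z)]) (E \<union> (\<Union>c'\<in>C'. stanley_set c' Z))"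
      unfolding E_eq .
    moreover have "set (cs' @ [(a, Z)]) = set cs \<union> C' \<times> {Z}" using cs'(2) a(1) by auto
    ultimately show ?case by blast
  qed
  from this[of C] obtain cs' where cs': "stanley_chain (upset B) cs' (E \<union> (\<Union>c'\<in>C. stanley_set c' Z))"
    "set cs' = set cs \<union> C \<times> {Z}" by blast
  have "(\<Union>c'\<in>C. stanley_set c' Z) = {e. trunc g e \<in> poset_interval ?P c d}"
    using in_C from_C by blast
  then have "E \<union> (\<Union>c'\<in>C. stanley_set c' Z) = upset B \<union> {e. trunc g e \<in> D}"
    unfolding E_def D0(2) by blast
  moreover have "\<forall>(c', Z)\<in>set cs'. \<exists>(c, d)\<in>set (cds @ [cd]). Z = Zvars g d"
    using cs(2) unfolding cs'(2) by (fastforce simp: cd_eq Z_def)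
  ultimately show ?case using cs'(1) by (intro exI[of _ cs']) simp
qed

end

subsection \<open>Prime filtrations\<close>

lemma (in presentation) image_mem_iff:
  assumes "is_ideal E" and "K \<subseteq> E" and "E \<subseteq> L" and "u \<in> L"
  shows "\<alpha> u \<in> \<alpha> ` E \<longleftrightarrow> u \<in> E"
proof
  assume "\<alpha> u \<in> \<alpha> ` E"
  then obtain v where "v \<in> E" "\<alpha> u = \<alpha> v" by blast
  then have "u - v \<in> K" using eq_iff[OF assms(4), of v] assms(3) by blast
  then have "u - v \<in> E" using assms(2) by blast
  from is_ideal_diff_left_iff[OF assms(1) this] show "u \<in> E" using \<open>v \<in> E\<close> by simp
qed (rule imageI)

lemma (in presentation) image_K: "\<alpha> ` K = {\<zero>\<^bsub>M\<^esub>}"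
proof -
  have "\<alpha> u = \<alpha> 0" if "u \<in> K" for u
    using eq_iff[of u 0] that K_le_L is_idealD(1)[OF ideal_L] by auto
  then have "\<alpha> ` K = (\<lambda>_. \<alpha> 0) ` K" by (intro image_cong refl)
  also have "\<dots> = {\<alpha> 0}" using is_idealD(1)[OF ideal_K] by blast
  finally show ?thesis by (simp only: zero_eq)
qed

lemma presentation_quot_mpoly_module:
  assumes "is_ideal I" and "is_ideal J" and "J \<subseteq> I"
  shows "presentation (gr_quot mpoly_module I J) I J (\<lambda>u. J +>\<^bsub>mpoly_module\<^esub> u)"
  using presentation.presentation_gr_quot[OF presentation_mpoly_module assms(2,1) _ assms(3)]
    is_idealD(1)[OF assms(2)] by simp

lemma presentation_quot_Z_prime:
  "presentation (gr_quot mpoly_module UNIV (Z_prime Z)) UNIV (Z_prime Z) (\<lambda>u. Z_prime Z +>\<^bsub>mpoly_module\<^esub> u)"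
  by (rule presentation_quot_mpoly_module[OF _ is_ideal_Z_prime]) (simp_all add: is_ideal_def)

lemma stanley_chain_up_closed: "stanley_chain E0 cs E \<Longrightarrow> up_closed E0 \<Longrightarrow> up_closed E"
  by (induction rule: stanley_chain.induct) auto

text \<open>Hides the existential shift, so that the reasoning about lists of submodules treats this
  clause of \<open>prime_filtration\<close> as atomic.\<close>

definition prime_quotient ::
    "(('n::finite, 'k::field) mpoly, 'm, 'n) gr_module \<Rightarrow> 'm set \<Rightarrow> 'm set \<Rightarrow> ('n, 'k) mpoly set \<Rightarrow> bool"
  where "prime_quotient M L N P \<longleftrightarrow>
    (\<exists>a. gr_iso (gr_quot M L N) (gr_shift (gr_quot mpoly_module UNIV P) (- a)))"

text \<open>The chain ends at an arbitrary \<open>E\<close> inside \<open>E1\<close>, so that the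
  filtration can grow with it. The apex of each new cone lies outside the previous set and witnesses
  strictness.\<close>

lemma stanley_chain_imp_filtration:
  fixes M :: "(('n::finite, 'k::field) mpoly, 'm, 'n) gr_module"
  assumes M: "presentation M (monomial_span E1) (monomial_span E0) \<alpha>"
    and E0: "up_closed E0"
    and chain: "stanley_chain E0 cs E" and "E \<subseteq> E1"
  shows "\<exists>Ms. length Ms = length cs + 1 \<and> (\<forall>N\<in>set Ms. gr_submodule N M) \<and>
    Ms ! 0 = {\<zero>\<^bsub>M\<^esub>} \<and> Ms ! length cs = \<alpha> ` monomial_span E \<and>
    (\<forall>i<length cs. Ms ! i \<subset> Ms ! (i + 1) \<and>
      prime_quotient M (Ms ! (i + 1)) (Ms ! i) (Z_prime (snd (cs ! i))))"
  using chain \<open>E \<subseteq> E1\<close>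
proof (induction rule: stanley_chain.induct)
  case Nil
  interpret presentation M "monomial_span E1" "monomial_span E0" \<alpha> by (rule M)
  have "gr_submodule (\<alpha> ` monomial_span E0) M"
    using E0 Nil by (intro gr_submodule_monomial_span monomial_span_mono)
  then show ?case using image_K by (intro exI[of _ "[\<alpha> ` monomial_span E0]"]) simp
next
  case (snoc cs E c Z)
  interpret presentation M "monomial_span E1" "monomial_span E0" \<alpha> by (rule M)
  let ?E' = "E \<union> stanley_set c Z" and ?n = "length cs"
  obtain Ms where Ms: "length Ms = ?n + 1" "\<forall>N\<in>set Ms. gr_submodule N M" "Ms ! 0 = {\<zero>\<^bsub>M\<^esub>}"
    "Ms ! ?n = \<alpha> ` monomial_span E"
    "\<forall>i<?n. Ms ! i \<subset> Ms ! (i + 1) \<and> prime_quotient M (Ms ! (i + 1)) (Ms ! i) (Z_prime (snd (cs ! i)))"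
  proof -
    have "E \<subseteq> E1" using snoc.prems by blast
    from snoc.IH[OF this] show thesis by (elim exE conjE) (rule that)
  qed
  have up: "up_closed E" by (rule stanley_chain_up_closed[OF snoc.hyps(1) E0])
  have sub: "monomial_span E0 \<subseteq> (monomial_span E :: ('n, 'k) mpoly set)"
    "monomial_span E \<subseteq> (monomial_span ?E' :: ('n, 'k) mpoly set)"
    "monomial_span ?E' \<subseteq> (monomial_span E1 :: ('n, 'k) mpoly set)"
    using stanley_chain_subset[OF snoc.hyps(1)] snoc.prems by (intro monomial_span_mono; blast)+
  note id = is_ideal_monomial_span[OF up] is_ideal_monomial_span[OF snoc.hyps(3)]
  have "xpow c \<in> (monomial_span ?E' :: ('n, 'k) mpoly set)" "xpow c \<notin> (monomial_span E :: ('n, 'k) mpoly set)"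
    using snoc.hyps(2) by (auto simp: stanley_set_def)
  then have strict: "\<alpha> ` monomial_span E \<subset> \<alpha> ` monomial_span ?E'"
  proof -
    have "\<alpha> (xpow c) \<notin> \<alpha> ` monomial_span E"
      using image_mem_iff[OF id(1) sub(1) order_trans[OF sub(2,3)], of "xpow c"] sub(3)
        \<open>xpow c \<in> monomial_span ?E'\<close> \<open>xpow c \<notin> monomial_span E\<close> by blast
    moreover have "\<alpha> (xpow c) \<in> \<alpha> ` monomial_span ?E'"
      using \<open>xpow c \<in> monomial_span ?E'\<close> by (rule imageI)
    ultimately show ?thesis using image_mono[OF sub(2), of \<alpha>] by blast
  qed
  have quot: "prime_quotient M (\<alpha> ` monomial_span ?E') (\<alpha> ` monomial_span E) (Z_prime Z)"
  proof -
    have "?E' - E = stanley_set c Z" using snoc.hyps(2) by blast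
    from gr_iso_stanley_set[OF presentation_gr_quot[OF id sub] presentation_quot_Z_prime snoc.hyps(3) this]
    show ?thesis unfolding prime_quotient_def by (rule exI[of _ "\<lambda>j. int (c j)"])
  qed
  have "gr_submodule (\<alpha> ` monomial_span ?E') M"
    by (rule gr_submodule_monomial_span[OF snoc.hyps(3) sub(3)])
  moreover define Ms' where "Ms' = Ms @ [\<alpha> ` monomial_span ?E']"
  moreover have "Ms' ! i \<subset> Ms' ! (i + 1) \<and>
      prime_quotient M (Ms' ! (i + 1)) (Ms' ! i) (Z_prime (snd ((cs @ [(c, Z)]) ! i)))" if "i < Suc ?n" for i
  proof (cases "i = ?n")
    case True
    then show ?thesis using Ms(1,4) strict quot by (simp add: Ms'_def nth_append)
  next
    case False
    then have "i < ?n" using that by simp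
    then show ?thesis using Ms(1) Ms(5)[rule_format, of i] by (simp add: Ms'_def nth_append)
  qed
  ultimately show ?case
    using Ms(1-3) by (intro exI[of _ Ms'] conjI) (simp_all add: nth_append)
qed

text \<open>Each member of the filtration is the image of a monomial span, and each quotient forces
  the new exponents to form a cone; the chain is built prefix by prefix.\<close>

lemma filtration_imp_stanley_chain:
  fixes M :: "(('n::finite, 'k::field) mpoly, 'm, 'n) gr_module"
  assumes M: "presentation M (monomial_span E1) (monomial_span E0) \<alpha>"
    and E: "up_closed E0" "up_closed E1" and filt: "prime_filtration M Ms Ps"
  shows "\<exists>cs. stanley_chain E0 cs E1 \<and> map (\<lambda>(c, Z). Z_prime Z) cs = Ps"
proof -
  interpret presentation M "monomial_span E1" "monomial_span E0" \<alpha> by (rule M)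
  have len: "length Ms = length Ps + 1" and sub: "\<And>i. i \<le> length Ps \<Longrightarrow> gr_submodule (Ms ! i) M"
    and ends: "Ms ! 0 = {\<zero>\<^bsub>M\<^esub>}" "Ms ! length Ps = carrier M"
    and step: "\<And>i. i < length Ps \<Longrightarrow> Ms ! i \<subset> Ms ! (i + 1) \<and> monomial_prime (Ps ! i) \<and>
      prime_quotient M (Ms ! (i + 1)) (Ms ! i) (Ps ! i)"
    using filt unfolding prime_filtration_def prime_quotient_def[symmetric] by simp_all
  \<comment> \<open>Exponent sets above \<open>E0\<close> can be compared through their images,
    since \<alpha> identifies only elements that differ by a member of
    \<open>monomial_span E0\<close>.\<close>
  have mono: "E \<subseteq> E'"
    if "\<alpha> ` monomial_span E \<subseteq> \<alpha> ` monomial_span E'" "E \<subseteq> E1" "up_closed E'" "E0 \<subseteq> E'" "E' \<subseteq> E1" for E E'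
  proof
    fix e assume "e \<in> E"
    then have "xpow e \<in> (monomial_span E :: ('n, 'k) mpoly set)" by simp
    then have "\<alpha> (xpow e) \<in> \<alpha> ` monomial_span E'" using that(1) by blast
    then show "e \<in> E'"
      using image_mem_iff[OF is_ideal_monomial_span[OF that(3)], of "xpow e"] that \<open>e \<in> E\<close>
        monomial_span_mono[of E0 E'] monomial_span_mono[of E' E1] by auto
  qed
  have "\<exists>cs E. stanley_chain E0 cs E \<and> E \<subseteq> E1 \<and> Ms ! k = \<alpha> ` monomial_span E \<and>
      map (\<lambda>(c, Z). Z_prime Z) cs = take k Ps" if "k \<le> length Ps" for k
    using that
  proof (induction k)
    case 0
    have "E0 \<subseteq> E1"
      using K_le_L by (metis subset_iff xpow_in_monomial_span)
    then show ?case
      using ends(1) image_K stanley_chain.Nil by (intro exI[of _ "[]"] exI[of _ E0]) simp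
  next
    case (Suc k)
    then obtain cs E where cs: "stanley_chain E0 cs E" "E \<subseteq> E1" "Ms ! k = \<alpha> ` monomial_span E"
      "map (\<lambda>(c, Z). Z_prime Z) cs = take k Ps" by auto
    have up: "up_closed E" by (rule stanley_chain_up_closed[OF cs(1) E(1)])
    have "E0 \<subseteq> E" by (rule stanley_chain_subset[OF cs(1)])
    obtain E' where E': "up_closed E'" "E0 \<subseteq> E'" "monomial_span E' \<subseteq> (monomial_span E1 :: ('n, 'k) mpoly set)"
        "Ms ! Suc k = \<alpha> ` monomial_span E'"
      using gr_submodule_imp_monomial_span[OF sub[OF Suc.prems] refl] by blast
    have "E' \<subseteq> E1" using E'(3) by (metis subset_iff xpow_in_monomial_span)
    have "k < length Ps" using Suc.prems by simp
    note step_k = step[OF this]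
    then obtain Z where Z: "Ps ! k = Z_prime Z" unfolding monomial_prime_iff by (elim conjE exE)
    then obtain a where
      iso: "gr_iso (gr_quot M (Ms ! (k + 1)) (Ms ! k)) (gr_shift (gr_quot mpoly_module UNIV (Z_prime Z)) (- a))"
      using step_k unfolding prime_quotient_def Z by (elim conjE exE)
    have "Ms ! k \<subset> Ms ! (k + 1)" using step_k by (rule conjunct1)
    then have "E \<subseteq> E'"
      using mono[OF _ cs(2) E'(1,2) \<open>E' \<subseteq> E1\<close>] cs(3) E'(4) by auto
    have "presentation (gr_quot M (Ms ! (k + 1)) (Ms ! k)) (monomial_span E') (monomial_span E)
        (\<lambda>u. \<alpha> ` monomial_span E +>\<^bsub>M\<^esub> \<alpha> u)"
      using presentation_gr_quot[OF is_ideal_monomial_span[OF up] is_ideal_monomial_span[OF E'(1)]]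
        \<open>E0 \<subseteq> E\<close> \<open>E \<subseteq> E'\<close> E'(3,4) cs(3) by (simp add: monomial_span_mono)
    from gr_iso_imp_stanley_set[OF this presentation_quot_Z_prime E'(1) iso]
    obtain c where c: "E' - E = stanley_set c Z" by blast
    then have E'_eq: "E' = E \<union> stanley_set c Z" using \<open>E \<subseteq> E'\<close> by blast
    have "stanley_chain E0 (cs @ [(c, Z)]) E'"
      unfolding E'_eq using c E'(1) by (intro stanley_chain.snoc cs(1)) (auto simp flip: E'_eq)
    moreover have "map (\<lambda>(c, Z). Z_prime Z) (cs @ [(c, Z)]) = take (Suc k) Ps"
      using cs(4) Z Suc.prems by (simp add: take_Suc_conv_app_nth)
    ultimately show ?case
      using \<open>E' \<subseteq> E1\<close> E'(4) by (intro exI[of _ "cs @ [(c, Z)]"] exI[of _ E'] conjI)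
  qed
  from this[of "length Ps"] obtain cs E where cs: "stanley_chain E0 cs E" "E \<subseteq> E1"
    "Ms ! length Ps = \<alpha> ` monomial_span E" "map (\<lambda>(c, Z). Z_prime Z) cs = Ps" by auto
  have "E1 \<subseteq> E"
    using mono[of E1 E] cs ends(2) stanley_chain_subset[OF cs(1)] stanley_chain_up_closed[OF cs(1) E(1)]
    by (simp add: carrier_eq)
  then have "E = E1" using cs(2) by blast
  then show ?thesis using cs(1,4) by (intro exI[of _ cs] conjI) simp_all
qed

text \<open>All summands of one interval have the same dimension, and there is at least one, with
  the lower end as apex. The minimum over summands is therefore one over intervals.\<close>

lemma sdepth_stanley_decomp:
  assumes "interval_partition P cds"
  shows "sdepth_decomp (stanley_decomp P J g cds) = Min ((\<lambda>(c, d). card (Zvars g d)) ` set cds)"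
proof -
  have mem: "c \<in> poset_interval P c d" if "(c, d) \<in> set cds" for c d
    using assms that by (auto simp: interval_partition_def poset_interval_def)
  have "(\<lambda>(u, Z). card Z) ` stanley_decomp P J g cds = (\<lambda>(c, d). card (Zvars g d)) ` set cds"
  proof
    show "(\<lambda>(u, Z). card Z) ` stanley_decomp P J g cds \<subseteq> (\<lambda>(c, d). card (Zvars g d)) ` set cds"
      by (force simp: stanley_decomp_def)
    show "(\<lambda>(c, d). card (Zvars g d)) ` set cds \<subseteq> (\<lambda>(u, Z). card Z) ` stanley_decomp P J g cds"
    proof
      fix m assume "m \<in> (\<lambda>(c, d). card (Zvars g d)) ` set cds"
      then obtain c d where cd: "(c, d) \<in> set cds" "m = card (Zvars g d)" by auto
      then have "(J +>\<^bsub>mpoly_module\<^esub> xpow c, Zvars g d) \<in> stanley_decomp P J g cds"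
        using mem[OF cd(1)] unfolding stanley_decomp_def by blast
      then show "m \<in> (\<lambda>(u, Z). card Z) ` stanley_decomp P J g cds" using cd(2) by force
    qed
  qed
  then show ?thesis by (simp add: sdepth_decomp_def)
qed

theorem corollary2p8:
  fixes I J :: "('n::finite, 'k::field) mpoly set"
    and A B :: "('n \<Rightarrow> nat) set"
    and g :: "'n \<Rightarrow> nat"
  assumes "finite A" and "finite B"
    and "I = monomial_ideal A" and "J = monomial_ideal B"
    and "J \<subset> I"
    and "\<forall>a\<in>A. a \<le> g" and "\<forall>b\<in>B. b \<le> g"
  defines "P \<equiv> char_poset A B g"
  defines "T \<equiv> {sdepth_decomp (stanley_decomp P J g cds) |cds.
      interval_partition P cds \<and>
      (\<forall>j\<le>length cds. poset_ideal P (\<Union>(c, d)\<in>set (take j cds). poset_interval P c d))}"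
  shows "finite T \<and> T \<noteq> {} \<and> fdepth (gr_quot mpoly_module I J) = enat (Max T)"
proof -
  have I: "I = monomial_span (upset A)" and J: "J = monomial_span (upset B)"
    using assms(3,4) by (simp_all add: monomial_ideal_eq)
  have M: "presentation (gr_quot mpoly_module I J) (monomial_span (upset A)) (monomial_span (upset B))
      (\<lambda>u. J +>\<^bsub>mpoly_module\<^esub> u)"
    using presentation_quot_mpoly_module[of I J] is_ideal_monomial_span[OF up_closed_upset] \<open>J \<subset> I\<close>
    unfolding I J by blast
  have sub: "upset B \<subseteq> upset A"
  proof
    fix e assume "e \<in> upset B"
    then have "xpow e \<in> J" by (simp add: J)
    then have "xpow e \<in> I" using \<open>J \<subset> I\<close> by blast
    then show "e \<in> upset A" by (simp add: I)
  qed
  have trunc_P: "trunc g e \<in> P \<longleftrightarrow> e \<in> upset A - upset B" for e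
    unfolding P_def by (rule trunc_in_char_poset_iff[OF assms(6,7)])
  \<comment> \<open>Strictness of \<open>J \<subset> I\<close> makes the poset nonempty, so that the
    minima below range over nonempty sets.\<close>
  have "upset A \<noteq> upset B" using \<open>J \<subset> I\<close> by (auto simp: I J)
  then obtain e where "e \<in> upset A - upset B" using sub by blast
  then have "P \<noteq> {}" using trunc_P[of e] by blast
  have fin_P: "finite P" unfolding P_def by (rule finite_char_poset[OF assms(6,7)])
  define s where "s cds = Min ((\<lambda>(c, d). card (Zvars g d)) ` set cds)" for cds :: "(('n \<Rightarrow> nat) \<times> ('n \<Rightarrow> nat)) list"
  have T: "T = s ` {cds. ordered_partition P cds P}"
  proof -
    have "T = {s cds |cds. ordered_partition P cds P}"
      unfolding T_def
      by (rule Collect_cong, rule ex_cong1) (auto simp: ordered_partition_iff s_def sdepth_stanley_decomp)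
    then show ?thesis by (simp only: setcompr_eq_image)
  qed
  have nonempty: "set cds \<noteq> {}" if "ordered_partition P cds P" for cds
    using that \<open>P \<noteq> {}\<close> by (auto simp: ordered_partition_def)
  have s_le: "s cds \<le> card (Zvars g d)" if "(c, d) \<in> set cds" for c d cds
    unfolding s_def using that by (intro Min_le) force+
  have s_attained: "\<exists>(c, d)\<in>set cds. s cds = card (Zvars g d)" if "ordered_partition P cds P" for cds
  proof -
    have "s cds \<in> (\<lambda>(c, d). card (Zvars g d)) ` set cds"
      unfolding s_def using nonempty[OF that] by (intro Min_in) auto
    then show ?thesis by fastforce
  qed
  have "T \<subseteq> {..card (UNIV :: 'n set)}"
  proof
    fix m assume "m \<in> T"
    then obtain cds where "ordered_partition P cds P" "m = s cds" by (auto simp: T)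
    with s_attained[of cds] obtain d where "m = card (Zvars g d)" by auto
    then show "m \<in> {..card (UNIV :: 'n set)}" by (simp add: card_mono)
  qed
  then have fin_T: "finite T" by (rule finite_subset) simp
  have "T \<noteq> {}"
    using ordered_partition_exists[OF fin_P, of P] by (auto simp: T poset_ideal_def)
  have "fdepth_filtration Ps \<le> enat (Max T)" if filt: "prime_filtration (gr_quot mpoly_module I J) Ms Ps"
    for Ms and Ps :: "('n, 'k) mpoly set list"
  proof -
    obtain cs where cs: "stanley_chain (upset B) cs (upset A)" "map (\<lambda>(c, Z). Z_prime Z) cs = Ps"
      using filtration_imp_stanley_chain[OF M up_closed_upset up_closed_upset filt] by blast
    have "P \<inter> upset A = P" by (auto simp: P_def char_poset_def upset_def)
    then obtain cds where cds: "ordered_partition P cds P" "\<forall>(c, d)\<in>set cds. \<exists>(c', Z)\<in>set cs. Z \<subseteq> Zvars g d"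
      using stanley_chain_imp_ordered_partition[OF assms(6,7) cs(1)] by (auto simp: P_def)
    \<comment> \<open>An interval that attains the minimum \<open>s cds\<close> is matched with a
      cone of the filtration of no larger dimension, which bounds the depth of the
      filtration.\<close>
    obtain c d where cd: "(c, d) \<in> set cds" "s cds = card (Zvars g d)"
      using s_attained[OF cds(1)] by blast
    obtain c' Z where Z: "(c', Z) \<in> set cs" "Z \<subseteq> Zvars g d" using cds(2) cd(1) by blast
    have "Z_prime Z \<in> set Ps" using Z(1) unfolding cs(2)[symmetric] by force
    then have "fdepth_filtration Ps \<le> krull_dim (mpoly_ring Quot (Z_prime Z :: ('n, 'k) mpoly set))"
      unfolding fdepth_filtration_def by (rule INF_lower)
    also have "\<dots> = enat (card Z)" by (rule krull_dim_quot_Z_prime)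
    also have "\<dots> \<le> enat (s cds)" using Z(2) cd(2) by (simp add: card_mono)
    also have "\<dots> \<le> enat (Max T)" using fin_T cds(1) by (simp add: T)
    finally show ?thesis .
  qed
  then have le: "fdepth (gr_quot mpoly_module I J) \<le> enat (Max T)"
    unfolding fdepth_def by (intro Sup_least) blast
  have "Max T \<in> T" using fin_T \<open>T \<noteq> {}\<close> by (rule Max_in)
  then obtain cds where cds: "ordered_partition P cds P" "Max T = s cds" by (auto simp: T)
  \<comment> \<open>The chain built from a partition of the whole poset ends at the exponents of
    \<open>I\<close>, as those outside \<open>J\<close> are exactly the ones truncating into
    \<open>P\<close>.\<close>
  have "upset B \<union> {e. trunc g e \<in> P} = upset A" using trunc_P sub by blast
  then obtain cs where cs: "stanley_chain (upset B) cs (upset A)"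
    "\<forall>(c', Z)\<in>set cs. \<exists>(c, d)\<in>set cds. Z = Zvars g d"
    using ordered_partition_imp_stanley_chain[OF assms(6,7) cds(1)[unfolded P_def]] by (auto simp: P_def)
  define Ps :: "('n, 'k) mpoly set list" where "Ps = map (\<lambda>(c, Z). Z_prime Z) cs"
  have "monomial_prime (Ps ! i)" "Ps ! i = Z_prime (snd (cs ! i))" if "i < length cs" for i
    using that by (auto simp: Ps_def monomial_prime_iff case_prod_unfold)
  moreover have "length Ps = length cs" by (simp add: Ps_def)
  moreover have "carrier (gr_quot mpoly_module I J) = (\<lambda>u. J +>\<^bsub>mpoly_module\<^esub> u) ` monomial_span (upset A)"
    by (rule presentation.carrier_eq[OF M])
  ultimately obtain Ms where filt: "prime_filtration (gr_quot mpoly_module I J) Ms Ps"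
    using stanley_chain_imp_filtration[OF M up_closed_upset cs(1) order_refl]
    unfolding prime_filtration_def prime_quotient_def[symmetric] by auto
  have "enat (Max T) \<le> fdepth_filtration Ps"
    unfolding fdepth_filtration_def
  proof (rule INF_greatest)
    fix Q assume "Q \<in> set Ps"
    then obtain c' Z where Z: "(c', Z) \<in> set cs" "Q = Z_prime Z" by (auto simp: Ps_def)
    then obtain c d where "(c, d) \<in> set cds" "Z = Zvars g d" using cs(2) by blast
    then show "enat (Max T) \<le> krull_dim (mpoly_ring Quot Q)"
      using s_le cds(2) by (simp add: Z(2) krull_dim_quot_Z_prime)
  qed
  also have "\<dots> \<le> fdepth (gr_quot mpoly_module I J)"
    unfolding fdepth_def using filt by (intro Sup_upper) blast
  finally show ?thesis using le fin_T \<open>T \<noteq> {}\<close> by simp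
qed

end
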